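(* Let $(X,Y,\mu,\nu,c)$ be a compact OT problem satisfying the strong uniqueness hypothesis (SU) and let $T_*$ be an optimal transport map. If $(T_k)_k$ is an approximating sequence of projection maps for $(X,Y,\mu,\nu,c)$, then $d_p(T_k,T_* )\to 0$ as $k\to\infty$ for all $1\le p<\infty$.
   Context: A compact OT problem is a quintuple $(X,Y,\mu,\nu,c)$ where $(X,d_X)$, $(Y,d_Y)$ are compact metric spaces, $\mu\in\mathcal{P}(X)$, $\nu\in\mathcal{P}(Y)$ are Borel probability measures and $c:X\times Y\to\mathbb{R}$ is continuous. $\mathcal{A}(\mu,\nu)$ is the set of Borel probability measures on $X\times Y$ with marginals $\mu,\nu$ (transport plans), and $\mathrm{K}[\pi]=\int c\,d\pi$. A transport map is a Borel map $T:X\to Y$ with $T_\#\mu=\nu$; it induces the plan $\pi_T=(\operatorname{Id}_X\times T)_\#\mu$, where $(\operatorname{Id}_X\times T)(x)=(x,T(x))$. An optimal transport plan minimizes $\mathrm{K}$ over $\mathcal{A}(\mu,\nu)$; an optimal transport map minimizes $\int_X c(x,T(x))\,d\mu(x)$ over transport maps. (SU): there is a unique optimal transport plan $\pi_*\in\mathcal{A}(\mu,\nu)$ and it is induced by a transport map $T_*$, i.e. $\pi_{T_*}=\pi_*$. (Then $T_*$ is an optimal transport map, unique up to $\mu$-null sets.) For Borel maps $T_1,T_2:X\to Y$: $d_p(T_1,T_2)=\left(\int_X d_Y(T_1(x),T_2(x))^p\,d\mu(x)\right)^{1/p}$. Discretization: for $h\ge 0$, an $h$-partition of a metric space $Z$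 is a finite family $\{(E_i,z_i)\}_{i\in I}$ where the $E_i$ are pairwise disjoint Borel sets covering $Z$, $z_i\in E_i$ and $\operatorname{diam}(E_i)\le h$. Given $h$-partitions $\{(E_i,x_i)\}_{i\in I}$ of $X$ and $\{(F_j,y_j)\}_{j\in J}$ of $Y$, put $\mu_i=\mu[E_i]$, $\nu_j=\nu[F_j]$. An $h$-plan is a family $\pi_h=(\pi_{ij})_{(i,j)\in I\times J}$ of nonnegative reals with $\sum_j\pi_{ij}=\mu_i$ for all $i$ and $\sum_i\pi_{ij}=\nu_j$ for all $j$, identified with the measure $\sum_{ij}\pi_{ij}\delta_{(x_i,y_j)}$. It is $\varepsilon$-optimal ($\varepsilon\ge 0$) if $\mathrm{K}[\pi_h]\le\varepsilon+\mathrm{K}[\tilde\pi_h]$ for every $h$-plan $\tilde\pi_h$ built from the same pair of $h$-partitions. An approximating sequence of discrete plans is a sequence $(\pi_k)_k$ such that each $\pi_k$ is an $\varepsilon_k$-optimal $h_k$-plan (partitions may vary with $k$) with $\varepsilon_k\to0$, $h_k\to 0$. Projection maps: given points $(y_j)_j$ in $Y$ (finitely many) and weights $w_j\ge0$, $\sum_jw_j=1$, let $V(y)=\sum_jw_jd_Y(y,y_j)$; $\hat y\in Y$ is an $\varepsilon$-approximate geometric median for $(y_j)_j$ with weights $(w_j)_j$ if $V(\hat y)\le V(y)+\varepsilon$ for all $y\in Y$. $(Y,d_Y)$ is normed if $Y$ is a convex subset of a vector space $\mathbb{V}$ and $d_Y$ is induced by a norm on $\mathbb{V}$; then the barycenter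 is $\sum_jw_jy_j\in Y$. Let $\pi_h$ be an $h$-plan and $T:X\to Y$ a Borel map which is constant on each $E_i$, with value $t_i$ on $E_i$. Let $I_+=\{i\in I:\mu_i>0\}$. For $Q\ge 0$: $T\in\mathcal{T}^Q_{GM}[\pi_h]$ if for all $i\in I_+$ the point $t_i$ is a $Qh$-approximate geometric median for $(y_j)_{j\in J}$ with weights $(\pi_{ij}/\mu_i)_{j\in J}$; when $(Y,d_Y)$ is normed, $T\in\mathcal{T}_B[\pi_h]$ if for all $i\in I_+$ the point $t_i$ is the barycenter of $(y_j)_{j\in J}$ with weights $(\pi_{ij}/\mu_i)_{j\in J}$ (if $Y$ is not normed, $\mathcal{T}_B[\pi_h]=\emptyset$). Set $\mathcal{T}^Q[\pi_h]=\mathcal{T}^Q_{GM}[\pi_h]\cup\mathcal{T}_B[\pi_h]$. An approximating sequence of projection maps is a sequence $(T_k)_k$ of Borel maps $X\to Y$ such that, for some fixed $Q\ge 0$ and some approximating sequence of discrete plans $(\pi_k)_k$, $T_k\in\mathcal{T}^Q[\pi_k]$ for all $k$. *)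

theory Defs
  imports "HOL-Probability.Probability"
begin

text \<open>The compact metric spaces \<open>X\<close> and \<open>Y\<close> are the types \<open>'a\<close> and \<open>'b\<close>. Plans live on
  the Borel sigma-algebra of the product topology on \<open>'a \<times> 'b\<close>.\<close>

definition compact_OT_problem ::
  "'a::metric_space measure \<Rightarrow> 'b::metric_space measure \<Rightarrow> ('a \<times> 'b \<Rightarrow> real) \<Rightarrow> bool" where
  "compact_OT_problem \<mu> \<nu> c \<longleftrightarrow>
     compact (UNIV :: 'a set) \<and> compact (UNIV :: 'b set) \<and>
     prob_space \<mu> \<and> sets \<mu> = sets borel \<and>
     prob_space \<nu> \<and> sets \<nu> = sets borel \<and>
     continuous_on UNIV c"

definition transport_plans ::
  "'a::metric_space measure \<Rightarrow> 'b::metric_space measure \<Rightarrow> ('a \<times> 'b) measure set" where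
  "transport_plans \<mu> \<nu> =
     {\<pi>. prob_space \<pi> \<and> sets \<pi> = sets borel \<and> distr \<pi> borel fst = \<mu> \<and> distr \<pi> borel snd = \<nu>}"

definition transport_cost :: "('a::metric_space \<times> 'b::metric_space \<Rightarrow> real) \<Rightarrow> ('a \<times> 'b) measure \<Rightarrow> real" where
  "transport_cost c \<pi> = (LINT z|\<pi>. c z)"

definition optimal_plan ::
  "('a::metric_space \<times> 'b::metric_space \<Rightarrow> real) \<Rightarrow> 'a measure \<Rightarrow> 'b measure \<Rightarrow> ('a \<times> 'b) measure \<Rightarrow> bool" where
  "optimal_plan c \<mu> \<nu> \<pi> \<longleftrightarrow>
     \<pi> \<in> transport_plans \<mu> \<nu> \<and>
     (\<forall>\<pi>' \<in> transport_plans \<mu> \<nu>. transport_cost c \<pi> \<le> transport_cost c \<pi>')"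

definition transport_map ::
  "'a::metric_space measure \<Rightarrow> 'b::metric_space measure \<Rightarrow> ('a \<Rightarrow> 'b) \<Rightarrow> bool" where
  "transport_map \<mu> \<nu> T \<longleftrightarrow> T \<in> borel_measurable borel \<and> distr \<mu> borel T = \<nu>"

definition induced_plan ::
  "'a::metric_space measure \<Rightarrow> ('a \<Rightarrow> 'b::metric_space) \<Rightarrow> ('a \<times> 'b) measure" where
  "induced_plan \<mu> T = distr \<mu> borel (\<lambda>x. (x, T x))"

definition optimal_map ::
  "('a::metric_space \<times> 'b::metric_space \<Rightarrow> real) \<Rightarrow> 'a measure \<Rightarrow> 'b measure \<Rightarrow> ('a \<Rightarrow> 'b) \<Rightarrow> bool" where
  "optimal_map c \<mu> \<nu> T \<longleftrightarrow>
     transport_map \<mu> \<nu> T \<and>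
     (\<forall>S. transport_map \<mu> \<nu> S \<longrightarrow> (LINT x|\<mu>. c (x, T x)) \<le> (LINT x|\<mu>. c (x, S x)))"

definition strong_uniqueness ::
  "('a::metric_space \<times> 'b::metric_space \<Rightarrow> real) \<Rightarrow> 'a measure \<Rightarrow> 'b measure \<Rightarrow> bool" where
  "strong_uniqueness c \<mu> \<nu> \<longleftrightarrow>
     (\<exists>\<pi>. optimal_plan c \<mu> \<nu> \<pi> \<and> (\<forall>\<pi>'. optimal_plan c \<mu> \<nu> \<pi>' \<longrightarrow> \<pi>' = \<pi>) \<and>
          (\<exists>T. transport_map \<mu> \<nu> T \<and> induced_plan \<mu> T = \<pi>))"

definition map_dist ::
  "real \<Rightarrow> 'a measure \<Rightarrow> ('a \<Rightarrow> 'b::metric_space) \<Rightarrow> ('a \<Rightarrow> 'b) \<Rightarrow> real" where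
  "map_dist p \<mu> T1 T2 = (LINT x|\<mu>. dist (T1 x) (T2 x) powr p) powr (1 / p)"

text \<open>A finite family \<open>(E\<^sub>i, z\<^sub>i)\<close>, \<open>i \<in> I\<close>. Only finite index sets occur, so they are taken to be
  sets of natural numbers.\<close>

record 'a tagged_family =
  idx :: "nat set"
  cell :: "nat \<Rightarrow> 'a set"
  tag :: "nat \<Rightarrow> 'a"

definition h_partition :: "real \<Rightarrow> 'a::metric_space tagged_family \<Rightarrow> bool" where
  "h_partition h P \<longleftrightarrow>
     0 \<le> h \<and> finite (idx P) \<and> disjoint_family_on (cell P) (idx P) \<and> (\<Union>i\<in>idx P. cell P i) = UNIV \<and>
     (\<forall>i\<in>idx P. cell P i \<in> sets borel \<and> tag P i \<in> cell P i \<and> diameter (cell P i) \<le> h)"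

definition h_plan ::
  "'a::metric_space measure \<Rightarrow> 'b::metric_space measure \<Rightarrow> real \<Rightarrow>
   'a tagged_family \<Rightarrow> 'b tagged_family \<Rightarrow> (nat \<Rightarrow> nat \<Rightarrow> real) \<Rightarrow> bool" where
  "h_plan \<mu> \<nu> h PX PY w \<longleftrightarrow>
     h_partition h PX \<and> h_partition h PY \<and>
     (\<forall>i\<in>idx PX. \<forall>j\<in>idx PY. 0 \<le> w i j) \<and>
     (\<forall>i\<in>idx PX. (\<Sum>j\<in>idx PY. w i j) = measure \<mu> (cell PX i)) \<and>
     (\<forall>j\<in>idx PY. (\<Sum>i\<in>idx PX. w i j) = measure \<nu> (cell PY j))"

text \<open>The measure \<open>\<Sum>\<^sub>i\<^sub>j w\<^sub>i\<^sub>j \<delta>(x\<^sub>i, y\<^sub>j)\<close>, as the push-forward of the weights on \<open>I \<times> J\<close>.\<close>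

definition plan_measure ::
  "'a::metric_space tagged_family \<Rightarrow> 'b::metric_space tagged_family \<Rightarrow> (nat \<Rightarrow> nat \<Rightarrow> real) \<Rightarrow>
   ('a \<times> 'b) measure" where
  "plan_measure PX PY w =
     distr (point_measure (idx PX \<times> idx PY) (\<lambda>(i, j). ennreal (w i j))) borel
       (\<lambda>(i, j). (tag PX i, tag PY j))"

definition eps_optimal_h_plan ::
  "('a::metric_space \<times> 'b::metric_space \<Rightarrow> real) \<Rightarrow> 'a measure \<Rightarrow> 'b measure \<Rightarrow> real \<Rightarrow> real \<Rightarrow>
   'a tagged_family \<Rightarrow> 'b tagged_family \<Rightarrow> (nat \<Rightarrow> nat \<Rightarrow> real) \<Rightarrow> bool" where
  "eps_optimal_h_plan c \<mu> \<nu> \<epsilon> h PX PY w \<longleftrightarrow>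
     0 \<le> \<epsilon> \<and> h_plan \<mu> \<nu> h PX PY w \<and>
     (\<forall>w'. h_plan \<mu> \<nu> h PX PY w' \<longrightarrow>
        transport_cost c (plan_measure PX PY w) \<le> \<epsilon> + transport_cost c (plan_measure PX PY w'))"

definition approximating_plans ::
  "('a::metric_space \<times> 'b::metric_space \<Rightarrow> real) \<Rightarrow> 'a measure \<Rightarrow> 'b measure \<Rightarrow> (nat \<Rightarrow> real) \<Rightarrow>
   (nat \<Rightarrow> 'a tagged_family) \<Rightarrow> (nat \<Rightarrow> 'b tagged_family) \<Rightarrow> (nat \<Rightarrow> nat \<Rightarrow> nat \<Rightarrow> real) \<Rightarrow> bool" where
  "approximating_plans c \<mu> \<nu> h PX PY w \<longleftrightarrow>
     (\<exists>\<epsilon>. (\<forall>k. eps_optimal_h_plan c \<mu> \<nu> (\<epsilon> k) (h k) (PX k) (PY k) (w k)) \<and>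
          \<epsilon> \<longlonglongrightarrow> 0 \<and> h \<longlonglongrightarrow> 0)"

definition approx_geometric_median ::
  "real \<Rightarrow> nat set \<Rightarrow> (nat \<Rightarrow> 'b::metric_space) \<Rightarrow> (nat \<Rightarrow> real) \<Rightarrow> 'b \<Rightarrow> bool" where
  "approx_geometric_median \<epsilon> J ys w t \<longleftrightarrow>
     (\<forall>y. (\<Sum>j\<in>J. w j * dist t (ys j)) \<le> (\<Sum>j\<in>J. w j * dist y (ys j)) + \<epsilon>)"

text \<open>A type \<open>'b\<close> is not itself a subset of a vector space, so the inclusion of \<open>Y\<close> into the
  normed space is an explicit map \<open>\<iota>\<close>: \<open>(Y, d\<^sub>Y)\<close> is normed via \<open>\<iota>\<close> if \<open>\<iota>\<close> identifies it with a
  convex subset carrying the metric induced by the norm.\<close>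

definition normed_via :: "('b::metric_space \<Rightarrow> 'v::real_normed_vector) \<Rightarrow> bool" where
  "normed_via \<iota> \<longleftrightarrow> convex (range \<iota>) \<and> (\<forall>y y'. dist y y' = norm (\<iota> y - \<iota> y'))"

definition projection_maps_GM ::
  "real \<Rightarrow> 'a::metric_space measure \<Rightarrow> real \<Rightarrow> 'a tagged_family \<Rightarrow> 'b::metric_space tagged_family \<Rightarrow>
   (nat \<Rightarrow> nat \<Rightarrow> real) \<Rightarrow> ('a \<Rightarrow> 'b) set" where
  "projection_maps_GM Q \<mu> h PX PY w =
     {T \<in> borel_measurable borel.
        \<exists>t. (\<forall>i\<in>idx PX. \<forall>x\<in>cell PX i. T x = t i) \<and>
            (\<forall>i\<in>idx PX. measure \<mu> (cell PX i) > 0 \<longrightarrow>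
               approx_geometric_median (Q * h) (idx PY) (tag PY)
                 (\<lambda>j. w i j / measure \<mu> (cell PX i)) (t i))}"

text \<open>As \<open>\<iota>\<close> is injective, the last equation says that \<open>t i\<close> is the barycenter. The set is empty
  if \<open>(Y, d\<^sub>Y)\<close> is not normed via \<open>\<iota>\<close>.\<close>

definition projection_maps_B ::
  "('b::metric_space \<Rightarrow> 'v::real_normed_vector) \<Rightarrow> 'a::metric_space measure \<Rightarrow>
   'a tagged_family \<Rightarrow> 'b tagged_family \<Rightarrow> (nat \<Rightarrow> nat \<Rightarrow> real) \<Rightarrow> ('a \<Rightarrow> 'b) set" where
  "projection_maps_B \<iota> \<mu> PX PY w =
     {T \<in> borel_measurable borel.
        normed_via \<iota> \<and>
        (\<exists>t. (\<forall>i\<in>idx PX. \<forall>x\<in>cell PX i. T x = t i) \<and>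
             (\<forall>i\<in>idx PX. measure \<mu> (cell PX i) > 0 \<longrightarrow>
                \<iota> (t i) = (\<Sum>j\<in>idx PY. (w i j / measure \<mu> (cell PX i)) *\<^sub>R \<iota> (tag PY j))))}"

definition projection_maps ::
  "('b::metric_space \<Rightarrow> 'v::real_normed_vector) \<Rightarrow> real \<Rightarrow> 'a::metric_space measure \<Rightarrow> real \<Rightarrow>
   'a tagged_family \<Rightarrow> 'b tagged_family \<Rightarrow> (nat \<Rightarrow> nat \<Rightarrow> real) \<Rightarrow> ('a \<Rightarrow> 'b) set" where
  "projection_maps \<iota> Q \<mu> h PX PY w =
     projection_maps_GM Q \<mu> h PX PY w \<union> projection_maps_B \<iota> \<mu> PX PY w"

definition approximating_projection_maps ::
  "('b::metric_space \<Rightarrow> 'v::real_normed_vector) \<Rightarrow> ('a::metric_space \<times> 'b \<Rightarrow> real) \<Rightarrow>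
   'a measure \<Rightarrow> 'b measure \<Rightarrow> (nat \<Rightarrow> 'a \<Rightarrow> 'b) \<Rightarrow> bool" where
  "approximating_projection_maps \<iota> c \<mu> \<nu> T \<longleftrightarrow>
     (\<exists>Q\<ge>0. \<exists>h PX PY w. approximating_plans c \<mu> \<nu> h PX PY w \<and>
        (\<forall>k. T k \<in> projection_maps \<iota> Q \<mu> (h k) (PX k) (PY k) (w k)))"

end

theory Submission imports Defs
begin

text \<open>Let \<open>M\<^sub>k\<close> be the law of \<open>(x, T\<^sub>*(x), y\<^sub>j)\<close>, where \<open>x\<close> is drawn from \<open>\<mu>\<close> and, for \<open>x\<close> in the cell
  \<open>E\<^sub>i\<close>, the index \<open>j\<close> is drawn with probability \<open>\<pi>\<^sub>i\<^sub>j / \<mu>\<^sub>i\<close>. In any weak limit of a subsequence, the first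
  two coordinates have law \<open>\<pi>\<^sub>*\<close>, which lives on the graph of \<open>T\<^sub>*\<close>; the first and third form an
  optimal plan, because the discretized \<open>\<pi>\<^sub>*\<close> competes with the almost optimal \<open>\<pi>\<^sub>k\<close>, so by uniqueness
  they have law \<open>\<pi>\<^sub>*\<close> as well. Hence the second and third coordinates agree in the limit, i.e. the mean
  \<open>V\<^sub>k(x)\<close> of \<open>d(T\<^sub>*(x), y\<^sub>j)\<close> over \<open>j\<close> tends to \<open>0\<close> in \<open>L\<^sup>1(\<mu>)\<close>. For medians and barycenters alike,
  \<open>d(T\<^sub>k(x), T\<^sub>*(x)) \<le> 2 V\<^sub>k(x) + Q h\<^sub>k\<close> almost everywhere, and \<open>d\<close> is bounded.\<close>

section \<open>Weak limits on compact metric spaces\<close>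

text \<open>For each m, finitely many balls of radius \<open>1 / Suc m\<close> cover the space; all
  these balls together are enumerated. A uniform \<open>N\<close> exists because each scale uses
  only finitely many of them. The family serves twice: as a countable base for measurability in
  products, and as the supply of digits for a real code of the points.\<close>

lemma compact_metric_fine_cover:
  assumes "compact (UNIV :: 'a::metric_space set)"
  obtains U :: "nat \<Rightarrow> 'a::metric_space set" where "\<And>n. open (U n)"
    and "\<And>e. 0 < e \<Longrightarrow> \<exists>N. \<forall>x. \<exists>n<N. x \<in> U n \<and> (\<forall>y\<in>U n. \<forall>z\<in>U n. dist y z < e)"
proof -
  have "\<exists>C. finite C \<and> (UNIV :: 'a set) \<subseteq> (\<Union>c\<in>C. ball c (1 / Suc m))" for m
  proof -
    have "(UNIV :: 'a set) \<subseteq> (\<Union>c\<in>UNIV. ball c (1 / Suc m))"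
      using centre_in_ball[of _ "1 / Suc m"] by fastforce
    then show ?thesis
      using compactE_image[OF assms, of UNIV "\<lambda>c. ball c (1 / Suc m)"] by (metis open_ball)
  qed
  then obtain C where C: "\<And>m. finite (C m)" "\<And>m. (UNIV :: 'a set) \<subseteq> (\<Union>c\<in>C m. ball c (1 / Suc m))"
    by metis
  define B where "B = (\<Union>m. (\<lambda>c. ball c (1 / Suc m)) ` C m)"
  have "countable B"
    unfolding B_def using C(1) by (intro countable_UN) (auto intro: countable_finite)
  moreover have "B \<noteq> {}"
    unfolding B_def using C(2)[of 0] by blast
  ultimately have rng: "range (from_nat_into B) = B"
    by (rule range_from_nat_into[rotated])
  show thesis
  proof
    show "open (from_nat_into B n)" for n
    proof -
      have "from_nat_into B n \<in> B" using rng by blast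
      then show ?thesis by (auto simp: B_def)
    qed
    fix e :: real assume "0 < e"
    then obtain m where m: "1 / Suc m < e / 2"
      using nat_approx_posE[of "e / 2"] by auto
    have "\<exists>n. from_nat_into B n = ball c (1 / Suc m)" if "c \<in> C m" for c
    proof -
      have "ball c (1 / Suc m) \<in> B" unfolding B_def using that by blast
      then show ?thesis using rng by (metis imageE)
    qed
    then obtain k where k: "\<And>c. c \<in> C m \<Longrightarrow> from_nat_into B (k c) = ball c (1 / Suc m)"
      by metis
    obtain N where N: "\<And>c. c \<in> C m \<Longrightarrow> k c < N"
      using finite_nat_bounded[of "k ` C m"] C(1)[of m] by blast
    have "\<exists>n<N. x \<in> from_nat_into B n \<and>
        (\<forall>y\<in>from_nat_into B n. \<forall>z\<in>from_nat_into B n. dist y z < e)" for x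
    proof -
      obtain c where c: "c \<in> C m" "x \<in> ball c (1 / Suc m)" using C(2)[of m] by blast
      have "dist y z < e" if "y \<in> ball c (1 / Suc m)" "z \<in> ball c (1 / Suc m)" for y z
      proof -
        have "dist y z \<le> dist c y + dist c z" by (rule dist_triangle3)
        then show ?thesis using that m by auto
      qed
      then show ?thesis using c k[OF c(1)] N[OF c(1)] by metis
    qed
    then show "\<exists>N. \<forall>x. \<exists>n<N. x \<in> from_nat_into B n \<and>
        (\<forall>y\<in>from_nat_into B n. \<forall>z\<in>from_nat_into B n. dist y z < e)" by blast
  qed
qed

text \<open>The target carries the Borel sets of the product topology, which for general metric
  spaces may exceed the product sigma-algebra. By compactness every open set is a countable union of
  rectangles \<open>U n \<times> V m\<close> from the two fine covers, so preimages of open sets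
  stay measurable.\<close>

lemma borel_measurable_Pair_compact:
  fixes f :: "'c \<Rightarrow> 'a::metric_space" and g :: "'c \<Rightarrow> 'b::metric_space"
  assumes "compact (UNIV :: 'a set)" "compact (UNIV :: 'b set)"
    and [measurable]: "f \<in> borel_measurable M" "g \<in> borel_measurable M"
  shows "(\<lambda>x. (f x, g x)) \<in> borel_measurable M"
proof (rule borel_measurableI)
  fix S :: "('a \<times> 'b) set" assume "open S"
  obtain U :: "nat \<Rightarrow> 'a set" where U: "\<And>n. open (U n)"
    "\<And>e. 0 < e \<Longrightarrow> \<exists>N. \<forall>x. \<exists>n<N. x \<in> U n \<and> (\<forall>y\<in>U n. \<forall>z\<in>U n. dist y z < e)"
    using compact_metric_fine_cover[OF assms(1)] by blast
  obtain V :: "nat \<Rightarrow> 'b set" where V: "\<And>n. open (V n)"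
    "\<And>e. 0 < e \<Longrightarrow> \<exists>N. \<forall>x. \<exists>n<N. x \<in> V n \<and> (\<forall>y\<in>V n. \<forall>z\<in>V n. dist y z < e)"
    using compact_metric_fine_cover[OF assms(2)] by blast
  have fine: "\<exists>n m. a \<in> U n \<and> b \<in> V m \<and> U n \<times> V m \<subseteq> S" if "(a, b) \<in> S" for a b
  proof -
    obtain A B where AB: "open A" "open B" "(a, b) \<in> A \<times> B" "A \<times> B \<subseteq> S"
      using \<open>open S\<close> \<open>(a, b) \<in> S\<close> by (rule open_prod_elim)
    obtain e1 where e1: "0 < e1" "ball a e1 \<subseteq> A" using AB openE by blast
    obtain e2 where e2: "0 < e2" "ball b e2 \<subseteq> B" using AB openE by blast
    obtain n where n: "a \<in> U n" "\<forall>y\<in>U n. \<forall>z\<in>U n. dist y z < e1" using U(2)[OF e1(1)] by blast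
    obtain m where m: "b \<in> V m" "\<forall>y\<in>V m. \<forall>z\<in>V m. dist y z < e2" using V(2)[OF e2(1)] by blast
    have "U n \<subseteq> A" using n e1(2) by (auto simp: subset_iff)
    moreover have "V m \<subseteq> B" using m e2(2) by (auto simp: subset_iff)
    ultimately show ?thesis using n m AB by blast
  qed
  have "(\<lambda>x. (f x, g x)) -` S \<inter> space M =
    (\<Union>(n, m)\<in>{(n, m). U n \<times> V m \<subseteq> S}. {x \<in> space M. f x \<in> U n} \<inter> {x \<in> space M. g x \<in> V m})"
    using fine by fast
  also have "\<dots> \<in> sets M"
  proof (intro sets.countable_UN')
    show "countable {(n, m). U n \<times> V m \<subseteq> S}" by auto
    have [measurable]: "U n \<in> sets borel" "V m \<in> sets borel" for n m using U V by auto
    show "(\<lambda>(n, m). {x \<in> space M. f x \<in> U n} \<inter> {x \<in> space M. g x \<in> V m}) `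
      {(n, m). U n \<times> V m \<subseteq> S} \<subseteq> sets M"
      by auto
  qed
  finally show "(\<lambda>x. (f x, g x)) -` S \<inter> space M \<in> sets M" .
qed

text \<open>The code of \<open>x\<close> is the number whose n-th digit in base 3 tells whether
  \<open>x\<close> lies in \<open>U n\<close>; the upper bound 3/2 is the full geometric series. In
  base 3 with digits 0 and 1 the tail after a digit weighs only half of that digit, whereas in base
  2 it could cancel it. The code is Borel, in general not continuous, but its inverse is uniformly
  continuous.\<close>

lemma compact_metric_real_code:
  assumes "compact (UNIV :: 'a::metric_space set)"
  obtains s :: "'a::metric_space \<Rightarrow> real" where "s \<in> borel_measurable borel" "\<And>x. 0 \<le> s x" "\<And>x. s x \<le> 3 / 2"
    and "\<And>e. 0 < e \<Longrightarrow> \<exists>d>0. \<forall>x y. \<bar>s x - s y\<bar> < d \<longrightarrow> dist x y < e"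
proof -
  obtain U :: "nat \<Rightarrow> 'a set" where U: "\<And>n. open (U n)"
    "\<And>e. 0 < e \<Longrightarrow> \<exists>N. \<forall>x. \<exists>n<N. x \<in> U n \<and> (\<forall>y\<in>U n. \<forall>z\<in>U n. dist y z < e)"
    using compact_metric_fine_cover[OF assms] by blast
  define a :: "'a \<Rightarrow> nat \<Rightarrow> real" where "a x n = (1/3)^n * indicator (U n) x" for x n
  define s where "s x = (\<Sum>n. a x n)" for x
  have geo: "summable (\<lambda>n. (1/3::real)^n)" by (rule summable_geometric) simp
  have sm: "summable (a x)" for x
    by (rule summable_comparison_test'[OF geo, of 0]) (auto simp: a_def indicator_def)
  have geo_sum: "(\<Sum>n. (1/3::real)^n) = 3 / 2"
    by (subst suminf_geometric) auto
  show thesis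
  proof
    have [measurable]: "U n \<in> sets borel" for n using U by auto
    show "s \<in> borel_measurable borel" unfolding s_def a_def by measurable
    show "0 \<le> s x" for x unfolding s_def by (intro suminf_nonneg sm) (auto simp: a_def)
    show "s x \<le> 3 / 2" for x
      unfolding s_def geo_sum[symmetric]
      by (intro suminf_le sm geo) (auto simp: a_def indicator_def)
    fix e :: real assume "0 < e"
    then obtain N where N: "\<And>x. \<exists>n<N. x \<in> U n \<and> (\<forall>y\<in>U n. \<forall>z\<in>U n. dist y z < e)"
      using U(2) by blast
    \<comment> \<open>The threshold comes from the first digit \<open>i < N\<close> at which two
      codes could differ: the digits before it cancel, it contributes \<open>(1/3)^i\<close>, and
      the tail takes back at most half of this. Hence close codes agree on the first
      \<open>N\<close> digits, and a small \<open>U n\<close> with \<open>n < N\<close> that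
      contains one point contains both.\<close>
    have "dist x y < e" if less: "\<bar>s x - s y\<bar> < (1/3)^N / 2" for x y
    proof -
      have agree: "x \<in> U n \<longleftrightarrow> y \<in> U n" if "n < N" for n
      proof (rule ccontr)
        assume ne: "\<not> (x \<in> U n \<longleftrightarrow> y \<in> U n)"
        define i where "i = (LEAST n. \<not> (x \<in> U n \<longleftrightarrow> y \<in> U n))"
        have i: "\<not> (x \<in> U i \<longleftrightarrow> y \<in> U i)" unfolding i_def by (rule LeastI, rule ne)
        have before: "x \<in> U j \<longleftrightarrow> y \<in> U j" if "j < i" for j
          using not_less_Least[OF that[unfolded i_def]] by blast
        have "i \<le> n" unfolding i_def by (rule Least_le, rule ne)
        define b where "b n = a x n - a y n" for n
        have smb: "summable b" unfolding b_def by (intro summable_diff sm)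
        have "s x - s y = (\<Sum>n. b n)" unfolding s_def b_def by (intro suminf_diff sm)
        also have "\<dots> = (\<Sum>n. b (n + Suc i)) + sum b {..<Suc i}"
          by (rule suminf_split_initial_segment[OF smb])
        also have "sum b {..<Suc i} = b i"
          using before by (simp add: b_def a_def indicator_def)
        finally have eq: "s x - s y = (\<Sum>n. b (n + Suc i)) + b i" .
        have bi: "\<bar>b i\<bar> = (1/3)^i"
          using i by (auto simp: b_def a_def indicator_def split: if_splits)
        have sg: "summable (\<lambda>n. (1/3::real)^(n + Suc i))"
          using summable_ignore_initial_segment[OF geo, of "Suc i"] by simp
        have "\<bar>\<Sum>n. b (n + Suc i)\<bar> \<le> (\<Sum>n. (1/3)^(n + Suc i))"
        proof -
          have "norm (\<Sum>n. b (n + Suc i)) \<le> (\<Sum>n. norm ((1/3::real)^(n + Suc i)))"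
            by (rule norm_suminf_le) (use sg in \<open>auto simp: b_def a_def indicator_def\<close>)
          then show ?thesis by simp
        qed
        \<comment> \<open>The tail is \<open>3 / 2 * (1/3)^Suc i\<close>, exactly half the weight of
          the differing digit.\<close>
        also have "\<dots> = (\<Sum>n. (1/3)^n) * (1/3)^Suc i"
          unfolding power_add by (rule suminf_mult2[OF geo, symmetric])
        also have "\<dots> = (1/3)^i / 2" by (simp add: geo_sum)
        finally have "\<bar>s x - s y\<bar> \<ge> (1/3)^i / 2" using eq bi by linarith
        moreover have "(1/3::real)^N \<le> (1/3)^i"
          using \<open>i \<le> n\<close> \<open>n < N\<close> by (intro power_decreasing) auto
        ultimately show False using less by linarith
      qed
      obtain n where "n < N" "x \<in> U n" "\<forall>y\<in>U n. \<forall>z\<in>U n. dist y z < e" using N by blast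
      then show ?thesis using agree by blast
    qed
    then show "\<exists>d>0. \<forall>x y. \<bar>s x - s y\<bar> < d \<longrightarrow> dist x y < e"
      by (intro exI[of _ "(1/3)^N / 2"]) auto
  qed
qed

text \<open>The hypothesis says that the inverse of \<open>s\<close> is uniformly continuous on the
  range. Such a map extends continuously to the closure, since compactness of the domain provides
  limits for the decoded sequences.\<close>

lemma continuous_decoding:
  fixes s :: "'a::metric_space \<Rightarrow> 'b::metric_space"
  assumes "compact (UNIV :: 'a set)"
    and s: "\<And>e. 0 < e \<Longrightarrow> \<exists>d>0. \<forall>x y. dist (s x) (s y) < d \<longrightarrow> dist x y < e"
  obtains g where "continuous_on (closure (range s)) g" "\<And>x. g (s x) = x"
proof -
  \<comment> \<open>The decoded value \<open>z\<close> of \<open>u\<close> is pinned down by one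
    property: points with codes near \<open>u\<close> are near \<open>z\<close>. Both that
    \<open>g\<close> inverts \<open>s\<close> and that \<open>g\<close> is continuous follow from it
    alone.\<close>
  have "\<exists>z. \<forall>e>0. \<exists>d>0. \<forall>x. dist (s x) u < d \<longrightarrow> dist x z < e" if u: "u \<in> closure (range s)" for u
  proof -
    obtain v where v: "\<And>n. v n \<in> range s" "v \<longlonglongrightarrow> u" using u unfolding closure_sequential by blast
    then have "\<forall>n. \<exists>y. v n = s y" by blast
    then obtain x where x: "\<And>n. v n = s (x n)" by metis
    obtain z r where r: "strict_mono (r :: nat \<Rightarrow> nat)" "(x \<circ> r) \<longlonglongrightarrow> z"
      using compact_imp_seq_compact[OF assms(1)] unfolding seq_compact_def by blast
    have lim: "(\<lambda>n. s (x (r n))) \<longlonglongrightarrow> u"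
      using LIMSEQ_subseq_LIMSEQ[OF v(2) r(1)] by (simp add: x o_def)
    have "\<exists>d>0. \<forall>y. dist (s y) u < d \<longrightarrow> dist y z < e" if "0 < e" for e
    proof -
      obtain d where d: "0 < d" "\<And>x y. dist (s x) (s y) < d \<Longrightarrow> dist x y < e / 2"
        using s[of "e / 2"] \<open>0 < e\<close> by auto
      have "dist y z < e" if y: "dist (s y) u < d / 2" for y
      proof -
        have "eventually (\<lambda>n. dist (s (x (r n))) u < d / 2 \<and> dist (x (r n)) z < e / 2) sequentially"
          using tendstoD[OF lim, of "d / 2"] tendstoD[OF r(2), of "e / 2"] \<open>0 < d\<close> \<open>0 < e\<close>
          by (auto intro: eventually_conj simp: o_def)
        then obtain n where n: "dist (s (x (r n))) u < d / 2" "dist (x (r n)) z < e / 2"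
          using eventually_happens'[OF sequentially_bot] by blast
        have "dist (s y) (s (x (r n))) < d" using y n(1) by (rule dist_triangle_half_l)
        then have "dist y (x (r n)) < e / 2" by (rule d(2))
        then show ?thesis using n(2) by (metis dist_triangle_half_r dist_commute)
      qed
      then show ?thesis using \<open>0 < d\<close> by (intro exI[of _ "d / 2"]) auto
    qed
    then show ?thesis by blast
  qed
  then obtain g where g: "\<And>u e. u \<in> closure (range s) \<Longrightarrow> 0 < e \<Longrightarrow>
      \<exists>d>0. \<forall>x. dist (s x) u < d \<longrightarrow> dist x (g u) < e" by metis
  show thesis
  proof
    show "g (s x) = x" for x
    proof (rule ccontr)
      assume "g (s x) \<noteq> x"
      then have pos: "0 < dist x (g (s x))" by simp
      have mem: "s x \<in> closure (range s)" by (rule subsetD[OF closure_subset]) simp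
      obtain d where "0 < d" "\<forall>y. dist (s y) (s x) < d \<longrightarrow> dist y (g (s x)) < dist x (g (s x))"
        using g[OF mem pos] by blast
      then have "dist x (g (s x)) < dist x (g (s x))" by (metis dist_self)
      then show False by simp
    qed
    show "continuous_on (closure (range s)) g"
      unfolding continuous_on_iff
    proof (intro ballI allI impI)
      fix u and e :: real assume u: "u \<in> closure (range s)" and e: "0 < e"
      obtain d where d: "0 < d" "\<And>x. dist (s x) u < d \<Longrightarrow> dist x (g u) < e / 2"
        using g[OF u, of "e / 2"] e by auto
      have "dist (g u') (g u) < e" if u': "u' \<in> closure (range s)" "dist u' u < d / 2" for u'
      proof -
        obtain d' where d': "0 < d'" "\<And>x. dist (s x) u' < d' \<Longrightarrow> dist x (g u') < e / 2"
          using g[OF u'(1), of "e / 2"] e by auto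
        \<comment> \<open>An auxiliary point whose code is close to \<open>u'\<close> and, through
          \<open>u'\<close>, also to \<open>u\<close>; both decoded values are then within
          \<open>e / 2\<close> of it.\<close>
        obtain x where x: "dist (s x) u' < min d' (d / 2)"
          using u'(1) d'(1) d(1) unfolding closure_approachable
          by (auto dest!: spec[of _ "min d' (d / 2)"])
        have "dist (s x) u < d" using x u'(2) dist_triangle[of "s x" u u'] by linarith
        then have "dist x (g u) < e / 2" by (rule d(2))
        moreover have "dist x (g u') < e / 2" using x by (intro d'(2)) simp
        ultimately show ?thesis using dist_triangle3[of "g u'" "g u" x] by linarith
      qed
      then show "\<exists>d>0. \<forall>x'\<in>closure (range s). dist x' u < d \<longrightarrow> dist (g x') (g u) < e"
        using d(1) by (intro exI[of _ "d / 2"]) auto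
    qed
  qed
qed

section \<open>Weak compactness and identification of measures by continuous functions\<close>

lemma bounded_continuous_compact:
  fixes f :: "'a::metric_space \<Rightarrow> real"
  assumes "compact (UNIV :: 'a set)" "continuous_on UNIV f"
  obtains B where "0 \<le> B" "\<And>x. \<bar>f x\<bar> \<le> B"
proof -
  have "bounded (range f)"
    using compact_continuous_image[OF assms(2,1)] by (rule compact_imp_bounded)
  then obtain B where "\<And>x. \<bar>f x\<bar> \<le> B" unfolding bounded_iff by auto
  then show thesis using that[of B] by (meson abs_ge_zero order_trans)
qed

lemma integrable_continuous_compact:
  fixes f :: "'a::metric_space \<Rightarrow> real"
  assumes "compact (UNIV :: 'a set)" "continuous_on UNIV f" "prob_space M"
    and [measurable]: "g \<in> borel_measurable M"
  shows "integrable M (\<lambda>x. f (g x))"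
proof -
  interpret prob_space M by fact
  obtain B where "\<And>x. \<bar>f x\<bar> \<le> B" using bounded_continuous_compact[OF assms(1,2)] by blast
  moreover have [measurable]: "f \<in> borel_measurable borel"
    using assms(2) by (rule borel_measurable_continuous_onI)
  ultimately show ?thesis by (intro integrable_const_bound[of _ B]) auto
qed

text \<open>Helly's theorem is only available on the real line: the sequence is pushed to the line by an
  injective Borel code, and the limit, which lives on the closure of the codes, is decoded.\<close>

lemma compact_prob_weak_limit:
  fixes M :: "nat \<Rightarrow> 'a::metric_space measure"
  assumes cpt: "compact (UNIV :: 'a set)"
    and pM: "\<And>n. prob_space (M n)" and sM: "\<And>n. sets (M n) = sets borel"
  obtains r N where "strict_mono r" "prob_space N" "sets N = sets borel"
    and "\<And>f :: 'a \<Rightarrow> real. continuous_on UNIV f \<Longrightarrow> (\<lambda>n. \<integral>x. f x \<partial>M (r n)) \<longlonglongrightarrow> (\<integral>x. f x \<partial>N)"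
proof -
  obtain s :: "'a \<Rightarrow> real" where s[measurable]: "s \<in> borel_measurable borel"
    and s0: "\<And>x. 0 \<le> s x" and s2: "\<And>x. s x \<le> 3 / 2"
    and sd: "\<And>e. 0 < e \<Longrightarrow> \<exists>d>0. \<forall>x y. \<bar>s x - s y\<bar> < d \<longrightarrow> dist x y < e"
    using compact_metric_real_code[OF cpt] by blast
  define K where "K = closure (range s)"
  obtain g where g: "continuous_on K g" "\<And>x. g (s x) = x"
    using continuous_decoding[OF cpt, of s] sd unfolding K_def dist_real_def by blast
  have sK: "s x \<in> K" for x unfolding K_def by (rule subsetD[OF closure_subset]) simp
  have K: "closed K" "K \<noteq> {}" using sK unfolding K_def by auto
  have [measurable_cong]: "sets (M n) = sets borel" for n by (rule sM)
  define R where "R n = distr (M n) borel s" for n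
  have dR: "real_distribution (R n)" for n
    unfolding R_def using pM by (intro prob_space.real_distribution_distr) auto
  \<comment> \<open>All codes lie between 0 and 3/2, so the interval from -1 to 2 carries the whole
    mass of every \<open>R n\<close>.\<close>
  have "tight R"
    unfolding tight_def
  proof (intro conjI allI impI dR)
    fix e :: real assume "0 < e"
    have "measure (R n) {-1<..2} = 1" for n
    proof -
      interpret prob_space "M n" by (rule pM)
      have "s x \<in> {-1<..2}" for x using s0[of x] s2[of x] by auto
      then have "s -` {-1<..2} \<inter> space (M n) = space (M n)" by blast
      then show ?thesis unfolding R_def by (subst measure_distr) (auto simp: prob_space)
    qed
    then show "\<exists>a b. a < b \<and> (\<forall>n. 1 - e < measure (R n) {a<..b})"
      using \<open>0 < e\<close> by (intro exI[of _ "-1"] exI[of _ 2]) auto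
  qed
  \<comment> \<open>The selection theorem refines a given subsequence; \<open>id\<close> stands for
    the whole sequence.\<close>
  then obtain r L where r: "strict_mono r" and L: "real_distribution L" "weak_conv_m (R \<circ> id \<circ> r) L"
    using tight_imp_convergent_subsubsequence[of R id] strict_mono_id by blast
  interpret L: real_distribution L by (rule L(1))
  have conv: "(\<lambda>n. \<integral>x. f (s x) \<partial>M (r n)) \<longlonglongrightarrow> (\<integral>u. f u \<partial>L)"
    if f: "continuous_on UNIV f" "\<And>u. \<bar>f u\<bar> \<le> B" for f :: "real \<Rightarrow> real" and B
  proof -
    have [measurable]: "f \<in> borel_measurable borel" using f(1) by (rule borel_measurable_continuous_onI)
    have "(\<lambda>n. \<integral>u. f u \<partial>(R \<circ> id \<circ> r) n) \<longlonglongrightarrow> (\<integral>u. f u \<partial>L)"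
      using f by (intro weak_conv_imp_integral_bdd_continuous_conv[OF _ L])
        (auto simp: dR continuous_on_eq_continuous_at)
    moreover have "(\<integral>u. f u \<partial>(R \<circ> id \<circ> r) n) = (\<integral>x. f (s x) \<partial>M (r n))" for n
      by (simp add: R_def integral_distr)
    ultimately show ?thesis by simp
  qed
  \<comment> \<open>The distance to \<open>K\<close> vanishes at all codes, so its integral vanishes
    in the limit too. Truncation at 1 makes it a bounded test function on the line.\<close>
  have LK: "AE u in L. u \<in> K"
  proof -
    have *: "continuous_on UNIV (\<lambda>u. min 1 (infdist u K))"
      by (intro continuous_intros)
    have [measurable]: "(\<lambda>u. min 1 (infdist u K)) \<in> borel_measurable borel"
      using * by (rule borel_measurable_continuous_onI)
    have "(\<lambda>n. \<integral>x. min 1 (infdist (s x) K) \<partial>M (r n)) \<longlonglongrightarrow> (\<integral>u. min 1 (infdist u K) \<partial>L)"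
      by (rule conv[OF *, of 1]) (auto simp: infdist_nonneg abs_le_iff intro: order_trans[OF _ infdist_nonneg])
    then have "(\<integral>u. min 1 (infdist u K) \<partial>L) = 0"
      using sK by (simp add: LIMSEQ_const_iff)
    moreover have "integrable L (\<lambda>u. min 1 (infdist u K))"
      by (intro L.integrable_const_bound[of _ 1]) (auto simp: infdist_nonneg)
    ultimately have "AE u in L. min 1 (infdist u K) = 0"
      by (subst (asm) integral_nonneg_eq_0_iff_AE) (auto simp: infdist_nonneg)
    then show ?thesis
      by eventually_elim (use K in \<open>auto simp: in_closed_iff_infdist_zero min_def split: if_splits\<close>)
  qed
  \<comment> \<open>The arbitrary value off \<open>K\<close> is harmless because \<open>L\<close>
    gives mass 0 to the complement of \<open>K\<close>; it makes the decoding a total Borel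
    map.\<close>
  define g' where "g' u = (if u \<in> K then g u else undefined)" for u
  have [measurable]: "g' \<in> borel_measurable borel"
    unfolding g'_def using K g(1) by (intro borel_measurable_continuous_on_if) auto
  show thesis
  proof
    show "strict_mono r" by (rule r)
    show "prob_space (distr L borel g')" by (rule L.prob_space_distr) simp
    show "sets (distr L borel g') = sets borel" by simp
    fix f :: "'a \<Rightarrow> real" assume f: "continuous_on UNIV f"
    have [measurable]: "f \<in> borel_measurable borel" using f by (rule borel_measurable_continuous_onI)
    obtain B where B: "0 \<le> B" "\<And>x. \<bar>f x\<bar> \<le> B" using bounded_continuous_compact[OF cpt f] by blast
    have "continuous_on K (\<lambda>u. f (g u))"
      using continuous_on_compose2[OF f g(1)] by simp
    \<comment> \<open>The test function \<open>f\<close> composed with \<open>g\<close> lives on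
      \<open>K\<close> only, while weak convergence on the line tests bounded continuous functions
      on all reals. The Tietze extension keeps the bound \<open>B\<close> and satisfies
      \<open>F (s x) = f x\<close>.\<close>
    then obtain F where F: "continuous_on UNIV F" "\<And>u. u \<in> K \<Longrightarrow> F u = f (g u)" "\<And>u. \<bar>F u\<bar> \<le> B"
      using Tietze[of K "\<lambda>u. f (g u)" UNIV B] K(1) B by auto
    have [measurable]: "F \<in> borel_measurable borel" using F(1) by (rule borel_measurable_continuous_onI)
    have "(\<integral>x. f x \<partial>distr L borel g') = (\<integral>u. f (g' u) \<partial>L)"
      by (rule integral_distr) auto
    also have "\<dots> = (\<integral>u. F u \<partial>L)"
    proof (rule integral_cong_AE)
      show "AE u in L. f (g' u) = F u" using LK by eventually_elim (simp add: F(2) g'_def)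
    qed measurable
    finally have "(\<integral>x. f x \<partial>distr L borel g') = (\<integral>u. F u \<partial>L)" .
    moreover have "F (s x) = f x" for x using F(2) sK g(2) by simp
    ultimately show "(\<lambda>n. \<integral>x. f x \<partial>M (r n)) \<longlonglongrightarrow> (\<integral>x. f x \<partial>distr L borel g')"
      using conv[OF F(1,3)] by simp
  qed
qed

text \<open>The indicator of an open set is the pointwise limit of the continuous functions
  \<open>min 1 (n * infdist x (- S))\<close>, so dominated convergence gives equality on open sets,
  a generator stable under intersection.\<close>

lemma measure_eqI_continuous:
  fixes M N :: "'a::metric_space measure"
  assumes fM: "finite_measure M" and fN: "finite_measure N"
    and sM: "sets M = sets borel" and sN: "sets N = sets borel"
    and eq: "\<And>f :: 'a \<Rightarrow> real. continuous_on UNIV f \<Longrightarrow> (\<integral>x. f x \<partial>M) = (\<integral>x. f x \<partial>N)"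
  shows "M = N"
proof (rule measure_eqI_generator_eq[where E="{S. open S}" and \<Omega>=UNIV and A="\<lambda>_. UNIV"])
  show "sets M = sigma_sets UNIV {S. open S}" "sets N = sigma_sets UNIV {S. open S}"
    by (simp_all add: sM sN sets_borel)
  show "emeasure M UNIV \<noteq> \<infinity>" using fM finite_measure.emeasure_finite by auto
  interpret M: finite_measure M by fact
  interpret N: finite_measure N by fact
  have [measurable_cong]: "sets M = sets borel" "sets N = sets borel" by fact+
  have space: "space M = UNIV" "space N = UNIV" using sets_eq_imp_space_eq[OF sM] sets_eq_imp_space_eq[OF sN] by simp_all
  fix S :: "'a set" assume "S \<in> {S. open S}"
  then have S: "open S" and [measurable]: "S \<in> sets borel" by auto
  have "measure M S = measure N S"
  \<comment> \<open>For the whole space the complement is empty, where \<open>infdist\<close> is 0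
    by convention, and the approximating functions would vanish; the constant 1 is tested
    instead.\<close>
  proof (cases "S = UNIV")
    case True
    then show ?thesis using eq[of "\<lambda>_. 1"] by (simp add: space)
  next
    case False
    define f where "f n x = min 1 (real n * infdist x (- S))" for n x
    have cf: "continuous_on UNIV (f n)" for n unfolding f_def by (intro continuous_intros)
    have [measurable]: "f n \<in> borel_measurable borel" for n
      using cf by (rule borel_measurable_continuous_onI)
    have b: "\<bar>f n x\<bar> \<le> 1" for n x by (simp add: f_def infdist_nonneg)
    have lim: "(\<lambda>n. f n x) \<longlonglongrightarrow> indicator S x" for x
    proof (cases "x \<in> S")
      case True
      then have "0 < infdist x (- S)"
        using False S in_closed_iff_infdist_zero[of "- S" x] infdist_nonneg[of x "- S"]
        by (metis ComplD Compl_UNIV_eq closed_Compl double_complement order_le_less)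
      then obtain m where m: "1 < real m * infdist x (- S)" using reals_Archimedean3 by blast
      have "f n x = 1" if "m \<le> n" for n
      proof -
        have "real m * infdist x (- S) \<le> real n * infdist x (- S)"
          using that by (intro mult_right_mono) (auto simp: infdist_nonneg)
        then show ?thesis using m by (simp add: f_def)
      qed
      then show ?thesis using True by (auto intro!: tendsto_eventually eventually_sequentiallyI)
    next
      case False
      then show ?thesis by (simp add: f_def)
    qed
    have "(\<lambda>n. \<integral>x. f n x \<partial>M) \<longlonglongrightarrow> (\<integral>x. indicator S x \<partial>M)"
      using lim b by (intro integral_dominated_convergence[where w="\<lambda>_. 1"]) auto
    moreover have "(\<lambda>n. \<integral>x. f n x \<partial>N) \<longlonglongrightarrow> (\<integral>x. indicator S x \<partial>N)"
      using lim b by (intro integral_dominated_convergence[where w="\<lambda>_. 1"]) auto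
    ultimately have "(\<integral>x. indicator S x \<partial>M) = (\<integral>x. indicator S x \<partial>N :: real)"
      using eq[OF cf] LIMSEQ_unique by simp blast
    then show ?thesis by (simp add: space)
  qed
  then show "emeasure M S = emeasure N S"
    by (simp add: M.emeasure_eq_measure N.emeasure_eq_measure)
qed (auto simp: Int_stable_def)

lemma borel_measurable_dist_compact:
  fixes f g :: "'c \<Rightarrow> 'a::metric_space"
  assumes "compact (UNIV :: 'a set)" "f \<in> borel_measurable M" "g \<in> borel_measurable M"
  shows "(\<lambda>x. dist (f x) (g x)) \<in> borel_measurable M"
proof -
  have "(\<lambda>z :: 'a \<times> 'a. dist (fst z) (snd z)) \<in> borel_measurable borel"
    by (intro borel_measurable_continuous_onI continuous_intros)
  from measurable_compose[OF borel_measurable_Pair_compact[OF assms(1,1,2,3)] this]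
  show ?thesis by simp
qed

section \<open>Finite kernels and step functions\<close>

text \<open>\<open>M\<close> is the law of \<open>G j x\<close> when \<open>x\<close> has law
  \<open>\<mu>\<close> and \<open>j\<close> is then drawn with probability \<open>W j x\<close>: a
  density on the product with counting measure, pushed forward by \<open>G\<close>. The integral
  formula covers bounded Borel functions, so that it can be used both for continuous functions and
  for indicators of cells.\<close>

lemma kernel_law:
  fixes \<mu> :: "'a measure" and G :: "nat \<Rightarrow> 'a \<Rightarrow> 'z::metric_space"
  assumes "prob_space \<mu>" and J: "finite J"
    and W[measurable]: "\<And>j. j \<in> J \<Longrightarrow> W j \<in> borel_measurable \<mu>"
    and G[measurable]: "\<And>j. j \<in> J \<Longrightarrow> G j \<in> borel_measurable \<mu>"
    and W01: "\<And>j x. j \<in> J \<Longrightarrow> 0 \<le> W j x" "\<And>j x. j \<in> J \<Longrightarrow> W j x \<le> 1"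
    and sum1: "AE x in \<mu>. (\<Sum>j\<in>J. W j x) = 1"
  obtains M where "prob_space M" "sets M = sets borel"
    and "\<And>(f :: 'z \<Rightarrow> real) B. f \<in> borel_measurable borel \<Longrightarrow> (\<And>z. \<bar>f z\<bar> \<le> B) \<Longrightarrow>
      (\<integral>z. f z \<partial>M) = (\<integral>x. (\<Sum>j\<in>J. W j x * f (G j x)) \<partial>\<mu>)"
proof -
  interpret prob_space \<mu> by fact
  interpret J: finite_measure "count_space J" using J by (rule finite_measure_count_space)
  interpret P: pair_sigma_finite "count_space J" \<mu> ..
  have fin: "finite_measure (count_space J \<Otimes>\<^sub>M \<mu>)"
    by (rule finite_measure_pair_measure) unfold_locales
  have cJ: "countable J" using J by (rule countable_finite)
  define D where "D = density (count_space J \<Otimes>\<^sub>M \<mu>) (\<lambda>(j, x). ennreal (W j x))"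
  \<comment> \<open>As \<open>J\<close> is countable, joint measurability reduces to measurability
    in \<open>x\<close> for each fixed \<open>j\<close>.\<close>
  have [measurable]: "(\<lambda>(j, x). W j x) \<in> borel_measurable (count_space J \<Otimes>\<^sub>M \<mu>)"
    by (rule measurable_pair_measure_countable1[OF cJ]) simp
  have [measurable]: "(\<lambda>(j, x). G j x) \<in> borel_measurable (count_space J \<Otimes>\<^sub>M \<mu>)"
    by (rule measurable_pair_measure_countable1[OF cJ]) simp
  have GD[measurable]: "(\<lambda>(j, x). G j x) \<in> borel_measurable D"
    unfolding D_def by simp
  have int: "(\<integral>z. f z \<partial>distr D borel (\<lambda>(j, x). G j x)) = (\<integral>x. (\<Sum>j\<in>J. W j x * f (G j x)) \<partial>\<mu>)"
    if [measurable]: "f \<in> borel_measurable borel" and B: "\<And>z. \<bar>f z\<bar> \<le> B" for f :: "'z \<Rightarrow> real" and B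
  proof -
    have bound: "\<bar>W j x * f (G j x)\<bar> \<le> B" if "j \<in> J" for j x
    proof -
      have "\<bar>W j x * f (G j x)\<bar> \<le> 1 * B"
        unfolding abs_mult using W01[OF that] B by (intro mult_mono) auto
      then show ?thesis by simp
    qed
    have i: "integrable (count_space J \<Otimes>\<^sub>M \<mu>) (\<lambda>(j, x). W j x * f (G j x))"
      by (rule finite_measure.integrable_const_bound[OF fin, of _ B])
        (auto simp: space_pair_measure bound split_beta' intro!: AE_I2)
    have "(\<integral>z. f z \<partial>distr D borel (\<lambda>(j, x). G j x)) = (\<integral>z. f (case z of (j, x) \<Rightarrow> G j x) \<partial>D)"
      by (rule integral_distr) auto
    also have "\<dots> = (\<integral>z. (case z of (j, x) \<Rightarrow> W j x) *\<^sub>R f (case z of (j, x) \<Rightarrow> G j x) \<partial>(count_space J \<Otimes>\<^sub>M \<mu>))"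
      unfolding D_def split_beta'
      by (rule integral_density) (auto simp: space_pair_measure W01 split_beta' intro!: AE_I2)
    also have "\<dots> = (\<integral>z. (case z of (j, x) \<Rightarrow> W j x * f (G j x)) \<partial>(count_space J \<Otimes>\<^sub>M \<mu>))"
      by (simp add: split_beta')
    also have "\<dots> = (\<integral>j. \<integral>x. W j x * f (G j x) \<partial>\<mu> \<partial>count_space J)"
      using P.integral_fst'[OF i] by simp
    also have "\<dots> = (\<Sum>j\<in>J. \<integral>x. W j x * f (G j x) \<partial>\<mu>)"
      by (rule lebesgue_integral_count_space_finite[OF J])
    also have "\<dots> = (\<integral>x. (\<Sum>j\<in>J. W j x * f (G j x)) \<partial>\<mu>)"
      using bound by (intro Bochner_Integration.integral_sum[symmetric] integrable_const_bound[of _ B]) auto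
    finally show ?thesis .
  qed
  \<comment> \<open>The total mass is read off from the integral formula for the constant 1. An
    infinite mass is then excluded, since its real-valued \<open>measure\<close> would be 0 instead
    of 1.\<close>
  have "(\<integral>z. 1 \<partial>distr D borel (\<lambda>(j, x). G j x)) = (1 :: real)"
  proof -
    have "(\<integral>z. 1 \<partial>distr D borel (\<lambda>(j, x). G j x)) = (\<integral>x. (\<Sum>j\<in>J. W j x * 1) \<partial>\<mu>)"
      by (rule int[of "\<lambda>_. 1" 1]) auto
    also have "\<dots> = (\<integral>x. 1 \<partial>\<mu>)"
      using sum1 by (intro integral_cong_AE) auto
    finally show ?thesis by (simp add: prob_space)
  qed
  then have m1: "measure (distr D borel (\<lambda>(j, x). G j x)) (space (distr D borel (\<lambda>(j, x). G j x))) = 1"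
    by simp
  then have "emeasure (distr D borel (\<lambda>(j, x). G j x)) (space (distr D borel (\<lambda>(j, x). G j x))) \<noteq> top"
    unfolding measure_def by (metis enn2real_top zero_neq_one)
  then have "prob_space (distr D borel (\<lambda>(j, x). G j x))"
    using m1 by (intro prob_spaceI) (metis emeasure_eq_ennreal_measure ennreal_1)
  then show thesis using int by (intro that[of "distr D borel (\<lambda>(j, x). G j x)"]) auto
qed

text \<open>The sum is the integral of the step function with value \<open>v i\<close> on
  \<open>C i\<close>. It differs from \<open>f\<close> by at most \<open>\<omega>\<close> pointwise,
  and the total mass is 1.\<close>

lemma abs_integral_step_le:
  fixes f :: "'z \<Rightarrow> real"
  assumes "prob_space P" "finite I" "disjoint_family_on C I" "space P \<subseteq> (\<Union>i\<in>I. C i)"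
    and [measurable]: "\<And>i. i \<in> I \<Longrightarrow> C i \<in> sets P"
    and f: "integrable P f"
    and close: "\<And>i z. i \<in> I \<Longrightarrow> z \<in> C i \<Longrightarrow> \<bar>f z - v i\<bar> \<le> \<omega>"
  shows "\<bar>(\<integral>z. f z \<partial>P) - (\<Sum>i\<in>I. measure P (C i) * v i)\<bar> \<le> \<omega>"
proof -
  interpret prob_space P by fact
  define S where "S z = (\<Sum>i\<in>I. indicator (C i) z * v i)" for z
  have S_eq: "S z = v i" if "i \<in> I" "z \<in> C i" for z i
  proof -
    have "z \<notin> C j" if "j \<in> I - {i}" for j
      using that \<open>i \<in> I\<close> \<open>z \<in> C i\<close> assms(3) by (auto simp: disjoint_family_on_def)
    then have "S z = (\<Sum>j\<in>{i}. indicator (C j) z * v j)"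
      unfolding S_def using assms(2) that by (intro sum.mono_neutral_right) auto
    then show ?thesis using that by simp
  qed
  have iS: "integrable P S"
    unfolding S_def
    by (intro Bochner_Integration.integrable_sum integrable_mult_left integrable_real_indicator)
      (auto simp: less_top[symmetric])
  have "(\<integral>z. S z \<partial>P) = (\<Sum>i\<in>I. measure P (C i) * v i)"
    unfolding S_def using sets.sets_into_space[OF assms(5)]
    by (subst Bochner_Integration.integral_sum) (auto intro!: sum.cong integrable_mult_left integrable_real_indicator
        simp: Int_absorb1 less_top[symmetric])
  then have "(\<integral>z. f z \<partial>P) - (\<Sum>i\<in>I. measure P (C i) * v i) = (\<integral>z. f z - S z \<partial>P)"
    using f iS by simp
  also have "\<bar>\<dots>\<bar> \<le> (\<integral>z. \<bar>f z - S z\<bar> \<partial>P)" by (rule integral_abs_bound)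
  also have "\<dots> \<le> (\<integral>z. \<omega> \<partial>P)"
  proof (rule integral_mono)
    fix z assume "z \<in> space P"
    then obtain i where "i \<in> I" "z \<in> C i" using assms(4) by blast
    then show "\<bar>f z - S z\<bar> \<le> \<omega>" using S_eq close by metis
  qed (use f iS in auto)
  finally show ?thesis by (simp add: prob_space)
qed

section \<open>Discretized plans\<close>

text \<open>On a cell of measure zero the quotient, and hence the weight, is \<open>0\<close>.\<close>

definition cell_weight ::
  "'a measure \<Rightarrow> 'a tagged_family \<Rightarrow> (nat \<Rightarrow> nat \<Rightarrow> real) \<Rightarrow> nat \<Rightarrow> 'a \<Rightarrow> real" where
  "cell_weight \<mu> P w j x = (\<Sum>i\<in>idx P. indicator (cell P i) x * (w i j / measure \<mu> (cell P i)))"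

text \<open>For an h-plan and continuous \<open>f\<close> this is the integral of \<open>f\<close>
  against the discrete plan. It is kept for arbitrary \<open>f\<close>, because the marginals of the
  limit are tested by functions other than the cost.\<close>

definition tag_cost ::
  "'a tagged_family \<Rightarrow> 'b tagged_family \<Rightarrow> (nat \<Rightarrow> nat \<Rightarrow> real) \<Rightarrow> ('a \<times> 'b \<Rightarrow> real) \<Rightarrow> real" where
  "tag_cost PX PY w f = (\<Sum>(i, j)\<in>idx PX \<times> idx PY. w i j * f (tag PX i, tag PY j))"

section \<open>Cells, weights and the glued law\<close>

lemma h_partition_dist_tag:
  assumes "compact (UNIV :: 'a::metric_space set)" "h_partition h P" "i \<in> idx P" "(x :: 'a) \<in> cell P i"
  shows "dist x (tag P i) \<le> h"
proof -
  have "bounded (cell P i)" using compact_imp_bounded[OF assms(1)] bounded_subset by blast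
  then have "dist x (tag P i) \<le> diameter (cell P i)"
    using assms by (intro diameter_bounded_bound) (auto simp: h_partition_def)
  also have "\<dots> \<le> h" using assms by (auto simp: h_partition_def)
  finally show ?thesis .
qed

lemma h_partition_cell_inj:
  assumes "h_partition h P" "i \<in> idx P" "i' \<in> idx P" "x \<in> cell P i" "x \<in> cell P i'"
  shows "i = i'"
  using assms by (auto simp: h_partition_def disjoint_family_on_def)

lemma h_partition_obtain_cell:
  assumes "h_partition h P"
  obtains i where "i \<in> idx P" "x \<in> cell P i"
  using assms by (auto simp: h_partition_def)

lemma cell_weight_eq:
  assumes P: "h_partition h P" and i: "i \<in> idx P" "x \<in> cell P i"
  shows "cell_weight \<mu> P w j x = w i j / measure \<mu> (cell P i)"
proof -
  have "x \<notin> cell P i'" if "i' \<in> idx P - {i}" for i'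
    using h_partition_cell_inj[OF P i(1) _ i(2)] that by blast
  then have "cell_weight \<mu> P w j x =
      (\<Sum>i'\<in>{i}. indicator (cell P i') x * (w i' j / measure \<mu> (cell P i')))"
    unfolding cell_weight_def using P i by (intro sum.mono_neutral_right) (auto simp: h_partition_def)
  then show ?thesis using i by simp
qed

text \<open>Besides bounding the conditional weights by 1, this forces \<open>w i j = 0\<close> on
  cells of measure zero.\<close>

lemma h_plan_le_measure:
  assumes "h_plan \<mu> \<nu> h PX PY w" "i \<in> idx PX" "j \<in> idx PY"
  shows "w i j \<le> measure \<mu> (cell PX i)"
proof -
  have "w i j \<le> (\<Sum>j\<in>idx PY. w i j)"
    using assms by (intro member_le_sum) (auto simp: h_plan_def h_partition_def)
  then show ?thesis using assms by (simp add: h_plan_def)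
qed

text \<open>Finitely many null cells form a null set, so almost every point lies in a cell by whose
  mass one may divide.\<close>

lemma h_plan_AE_pos:
  assumes "prob_space \<mu>" and [measurable_cong]: "sets \<mu> = sets borel" and P: "h_partition h P"
  shows "AE x in \<mu>. \<forall>i\<in>idx P. x \<in> cell P i \<longrightarrow> 0 < measure \<mu> (cell P i)"
proof -
  interpret prob_space \<mu> by fact
  have "AE x in \<mu>. x \<in> cell P i \<longrightarrow> 0 < measure \<mu> (cell P i)" if "i \<in> idx P" for i
  proof (cases "measure \<mu> (cell P i) = 0")
    case True
    have "cell P i \<in> sets \<mu>" using P that by (auto simp: h_partition_def assms(2))
    then have "cell P i \<in> null_sets \<mu>" using True by (auto simp: emeasure_eq_measure null_sets_def)
    from AE_not_in[OF this] show ?thesis by eventually_elim simp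
  next
    case False
    then show ?thesis by (simp add: zero_less_measure_iff)
  qed
  then show ?thesis using P by (intro AE_finite_allI) (auto simp: h_partition_def)
qed

lemma cell_weight_bounds:
  assumes plan: "h_plan \<mu> \<nu> h PX PY w" and j: "j \<in> idx PY"
  shows "0 \<le> cell_weight \<mu> PX w j x" "cell_weight \<mu> PX w j x \<le> 1"
proof -
  have P: "h_partition h PX" using plan by (simp add: h_plan_def)
  obtain i where i: "i \<in> idx PX" "x \<in> cell PX i" using h_partition_obtain_cell[OF P] .
  have "0 \<le> w i j" using plan i j by (simp add: h_plan_def)
  then show "0 \<le> cell_weight \<mu> PX w j x" "cell_weight \<mu> PX w j x \<le> 1"
    unfolding cell_weight_eq[OF P i] using h_plan_le_measure[OF plan i(1) j]
    by (auto intro!: divide_le_eq_1[THEN iffD2] simp: order_le_less)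
qed

lemma cell_weight_sum:
  assumes plan: "h_plan \<mu> \<nu> h PX PY w" and i: "i \<in> idx PX" "x \<in> cell PX i"
    and "0 < measure \<mu> (cell PX i)"
  shows "(\<Sum>j\<in>idx PY. cell_weight \<mu> PX w j x) = 1"
proof -
  have P: "h_partition h PX" using plan by (simp add: h_plan_def)
  show ?thesis
    unfolding cell_weight_eq[OF P i] sum_divide_distrib[symmetric]
    using plan i assms(4) by (simp add: h_plan_def)
qed

lemma measurable_cell_weight:
  assumes "h_partition h P" "sets \<mu> = sets borel"
  shows "cell_weight \<mu>' P w j \<in> borel_measurable \<mu>"
proof -
  have [measurable]: "\<And>i. i \<in> idx P \<Longrightarrow> cell P i \<in> sets \<mu>"
    using assms by (auto simp: h_partition_def)
  show ?thesis unfolding cell_weight_def[abs_def] by measurable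
qed

text \<open>The middle coordinate carries the value of \<open>S\<close>, so that the discontinuous function
  \<open>dist (S x) y\<close> becomes a continuous function of the three coordinates.\<close>

lemma glued_plan:
  fixes \<mu> :: "'a::metric_space measure" and \<nu> :: "'b::metric_space measure" and S :: "'a \<Rightarrow> 'b"
  assumes cX: "compact (UNIV :: 'a set)" and cY: "compact (UNIV :: 'b set)"
    and "prob_space \<mu>" and sets_mu[measurable_cong]: "sets \<mu> = sets borel"
    and S[measurable]: "S \<in> borel_measurable borel"
    and plan: "h_plan \<mu> \<nu> h PX PY w"
  obtains M :: "('a \<times> 'b \<times> 'b) measure" where "prob_space M" "sets M = sets borel"
    and "\<And>f :: 'a \<times> 'b \<times> 'b \<Rightarrow> real. continuous_on UNIV f \<Longrightarrow>
      (\<integral>z. f z \<partial>M) = (\<integral>x. (\<Sum>j\<in>idx PY. cell_weight \<mu> PX w j x * f (x, S x, tag PY j)) \<partial>\<mu>)"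
    and "\<And>f :: 'a \<times> 'b \<Rightarrow> real. continuous_on UNIV f \<Longrightarrow>
      (\<integral>z. f (fst z, fst (snd z)) \<partial>M) = (\<integral>x. f (x, S x) \<partial>\<mu>)"
    and "\<And>i j. i \<in> idx PX \<Longrightarrow> j \<in> idx PY \<Longrightarrow>
      measure M {z. fst z \<in> cell PX i \<and> snd (snd z) \<in> cell PY j} = w i j"
proof -
  interpret prob_space \<mu> by fact
  have PX: "h_partition h PX" and PY: "h_partition h PY" using plan by (auto simp: h_plan_def)
  have cYY: "compact (UNIV :: ('b \<times> 'b) set)"
    using compact_Times[OF cY cY] by simp
  have cZ: "compact (UNIV :: ('a \<times> 'b \<times> 'b) set)"
    using compact_Times[OF cX cYY] by simp
  define W where "W = cell_weight \<mu> PX w"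
  define G where "G j x = (x, S x, tag PY j)" for j x
  have G[measurable]: "G j \<in> borel_measurable \<mu>" for j
    unfolding G_def by (intro borel_measurable_Pair_compact cX cYY cY) measurable
  have W[measurable]: "W j \<in> borel_measurable \<mu>" for j
    unfolding W_def by (rule measurable_cell_weight[OF PX sets_mu])
  have finJ: "finite (idx PY)" using PY by (simp add: h_partition_def)
  \<comment> \<open>This can hold only almost everywhere: on a null cell every weight is 0.\<close>
  have sum1: "AE x in \<mu>. (\<Sum>j\<in>idx PY. W j x) = 1"
    using h_plan_AE_pos[OF assms(3) sets_mu PX]
  proof eventually_elim
    case (elim x)
    obtain i where i: "i \<in> idx PX" "x \<in> cell PX i" using h_partition_obtain_cell[OF PX] .
    then show ?case unfolding W_def using elim by (intro cell_weight_sum[OF plan i]) auto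
  qed
  obtain M where M: "prob_space M" and sets_M[measurable_cong]: "sets M = sets borel"
    and int: "\<And>(f :: 'a \<times> 'b \<times> 'b \<Rightarrow> real) B. f \<in> borel_measurable borel \<Longrightarrow> (\<And>z. \<bar>f z\<bar> \<le> B) \<Longrightarrow>
      (\<integral>z. f z \<partial>M) = (\<integral>x. (\<Sum>j\<in>idx PY. W j x * f (G j x)) \<partial>\<mu>)"
    by (rule kernel_law[of \<mu> "idx PY" W G])
      (use assms(3) finJ sum1 cell_weight_bounds[OF plan] in \<open>auto simp: W_def[symmetric]\<close>)
  have cont: "(\<integral>z. f z \<partial>M) = (\<integral>x. (\<Sum>j\<in>idx PY. W j x * f (G j x)) \<partial>\<mu>)"
    if f: "continuous_on UNIV f" for f :: "'a \<times> 'b \<times> 'b \<Rightarrow> real"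
  proof -
    obtain B where "\<And>z. \<bar>f z\<bar> \<le> B" using bounded_continuous_compact[OF cZ f] by blast
    then show ?thesis by (intro int[of _ B] borel_measurable_continuous_onI f)
  qed
  have marg: "(\<integral>z. f (fst z, fst (snd z)) \<partial>M) = (\<integral>x. f (x, S x) \<partial>\<mu>)"
    if f: "continuous_on UNIV f" for f :: "'a \<times> 'b \<Rightarrow> real"
  proof -
    have fm[measurable]: "f \<in> borel_measurable borel" using f by (rule borel_measurable_continuous_onI)
    have [measurable]: "(\<lambda>x. (x, S x)) \<in> borel_measurable \<mu>"
      by (intro borel_measurable_Pair_compact cX cY) measurable
    have [measurable]: "(\<lambda>x. f (x, S x)) \<in> borel_measurable \<mu>" by measurable
    have "continuous_on UNIV (\<lambda>z :: 'a \<times> 'b \<times> 'b. f (fst z, fst (snd z)))"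
      by (rule continuous_on_compose2[OF f]) (auto intro!: continuous_intros)
    then have "(\<integral>z. f (fst z, fst (snd z)) \<partial>M) = (\<integral>x. (\<Sum>j\<in>idx PY. W j x * f (x, S x)) \<partial>\<mu>)"
      by (subst cont) (auto simp: G_def)
    also have "\<dots> = (\<integral>x. f (x, S x) \<partial>\<mu>)"
      using sum1 by (intro integral_cong_AE) (auto simp: sum_distrib_right[symmetric])
    finally show ?thesis .
  qed
  have cells: "measure M {z. fst z \<in> cell PX i \<and> snd (snd z) \<in> cell PY j} = w i j"
    if i: "i \<in> idx PX" and j: "j \<in> idx PY" for i j
  proof -
    have ci[measurable]: "cell PX i \<in> sets borel" "cell PY j \<in> sets borel"
      using PX PY i j by (auto simp: h_partition_def)
    have [measurable]: "(\<lambda>z :: 'a \<times> 'b \<times> 'b. fst z) \<in> borel_measurable borel"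
      "(\<lambda>z :: 'a \<times> 'b \<times> 'b. snd (snd z)) \<in> borel_measurable borel"
      by (intro borel_measurable_continuous_onI continuous_intros)+
    define A where "A = {z :: 'a \<times> 'b \<times> 'b. fst z \<in> cell PX i \<and> snd (snd z) \<in> cell PY j}"
    have A[measurable]: "A \<in> sets borel"
    proof -
      have "{z \<in> space borel. fst z \<in> cell PX i \<and> snd (snd z) \<in> cell PY j} \<in>
        sets (borel :: ('a \<times> 'b \<times> 'b) measure)" by measurable
      then show ?thesis by (simp add: A_def)
    qed
    \<comment> \<open>Each tag lies in its own cell and in no other, so the indicator of the product
      cell selects the single index \<open>j\<close> from the sum.\<close>
    have tag: "tag PY j' \<in> cell PY j \<longleftrightarrow> j' = j" if "j' \<in> idx PY" for j'
      using h_partition_cell_inj[OF PY that j] that j PY by (auto simp: h_partition_def)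
    have pt: "(\<Sum>j'\<in>idx PY. W j' x * indicator A (G j' x)) =
        indicator (cell PX i) x * (w i j / measure \<mu> (cell PX i))" for x
    proof (cases "x \<in> cell PX i")
      case True
      have "(\<Sum>j'\<in>idx PY. W j' x * indicator A (G j' x)) = (\<Sum>j'\<in>idx PY. if j' = j then W j' x else 0)"
        using True tag by (intro sum.cong) (auto simp: A_def G_def indicator_def)
      also have "\<dots> = W j x" using finJ j by simp
      finally show ?thesis using True by (simp add: W_def cell_weight_eq[OF PX i True])
    qed (simp add: A_def G_def)
    have "measure M A = (\<integral>z. indicator A z \<partial>M)"
      using sets_eq_imp_space_eq[OF sets_M] by simp
    also have "\<dots> = (\<integral>x. (\<Sum>j'\<in>idx PY. W j' x * indicator A (G j' x)) \<partial>\<mu>)"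
      by (rule int[of _ 1]) (auto simp: indicator_def)
    also have "\<dots> = measure \<mu> (cell PX i) * (w i j / measure \<mu> (cell PX i))"
      unfolding pt using sets_eq_imp_space_eq[OF sets_mu] by simp
    also have "\<dots> = w i j"
    \<comment> \<open>On a null cell the left-hand side is 0, and \<open>w i j\<close> is squeezed
      between 0 and the mass 0.\<close>
    proof (cases "measure \<mu> (cell PX i) = 0")
      case True
      have "0 \<le> w i j" using plan i j by (simp add: h_plan_def)
      then show ?thesis using True h_plan_le_measure[OF plan i j] by simp
    qed simp
    finally show ?thesis by (simp add: A_def)
  qed
  show thesis
    by (rule that[OF M sets_M _ marg cells]) (auto simp: cont W_def G_def)
qed

section \<open>Discrete costs against integrals\<close>

lemma transport_cost_plan_measure:
  fixes \<mu> :: "'a::metric_space measure" and \<nu> :: "'b::metric_space measure"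
  assumes "h_plan \<mu> \<nu> h PX PY w" "continuous_on UNIV c"
  shows "transport_cost c (plan_measure PX PY w) = tag_cost PX PY w c"
proof -
  have fin: "finite (idx PX \<times> idx PY)" using assms(1) by (auto simp: h_plan_def h_partition_def)
  have "c \<in> borel_measurable borel" using assms(2) by (rule borel_measurable_continuous_onI)
  then have "transport_cost c (plan_measure PX PY w) =
      (\<integral>z. c (case z of (i, j) \<Rightarrow> (tag PX i, tag PY j))
        \<partial>point_measure (idx PX \<times> idx PY) (\<lambda>z. ennreal (case z of (i, j) \<Rightarrow> w i j)))"
    unfolding transport_cost_def plan_measure_def
    by (subst integral_distr) (auto simp: split_beta')
  also have "\<dots> = tag_cost PX PY w c"
    unfolding tag_cost_def using assms(1)
    by (subst lebesgue_integral_point_measure_finite[OF fin]) (auto simp: h_plan_def split_beta')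
  finally show ?thesis .
qed

text \<open>On the set where \<open>X\<close> is in cell i and \<open>Y\<close> in cell j, both
  values are within \<open>h\<close> of the tags, so \<open>f\<close> moves by at most
  \<open>\<omega>\<close>. The maps \<open>X\<close> and \<open>Y\<close> are left general because
  two cases are needed: the first and third coordinates of the glued law, and the two coordinates of
  a transport plan.\<close>

lemma tag_cost_approx:
  fixes f :: "'a::metric_space \<times> 'b::metric_space \<Rightarrow> real" and P :: "'z::metric_space measure"
  assumes cX: "compact (UNIV :: 'a set)" and cY: "compact (UNIV :: 'b set)"
    and f: "continuous_on UNIV f"
    and "prob_space P" and sets_P[measurable_cong]: "sets P = sets borel"
    and [measurable]: "X \<in> borel_measurable borel" "Y \<in> borel_measurable borel"
    and PX: "h_partition h PX" and PY: "h_partition h PY"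
    and w: "\<And>i j. i \<in> idx PX \<Longrightarrow> j \<in> idx PY \<Longrightarrow> measure P {z. X z \<in> cell PX i \<and> Y z \<in> cell PY j} = w i j"
    and close: "\<And>x x' y y'. dist x x' \<le> h \<Longrightarrow> dist y y' \<le> h \<Longrightarrow> \<bar>f (x, y) - f (x', y')\<bar> \<le> \<omega>"
  shows "\<bar>(\<integral>z. f (X z, Y z) \<partial>P) - tag_cost PX PY w f\<bar> \<le> \<omega>"
proof -
  define C where "C = (\<lambda>(i, j). {z. X z \<in> cell PX i \<and> Y z \<in> cell PY j})"
  have XY: "(\<lambda>z. (X z, Y z)) \<in> borel_measurable P"
    by (intro borel_measurable_Pair_compact cX cY) measurable
  have cXY: "compact (UNIV :: ('a \<times> 'b) set)" using compact_Times[OF cX cY] by simp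
  have sp: "space P = UNIV" using sets_eq_imp_space_eq[OF sets_P] by simp
  have C: "C p \<in> sets P" if "p \<in> idx PX \<times> idx PY" for p
  proof -
    have [measurable]: "cell PX (fst p) \<in> sets borel" "cell PY (snd p) \<in> sets borel"
      using that PX PY by (auto simp: h_partition_def)
    have "{z \<in> space P. X z \<in> cell PX (fst p) \<and> Y z \<in> cell PY (snd p)} \<in> sets P" by measurable
    then show ?thesis by (simp add: C_def split_beta' sp)
  qed
  have "\<bar>(\<integral>z. f (X z, Y z) \<partial>P) -
      (\<Sum>p\<in>idx PX \<times> idx PY. measure P (C p) * f (tag PX (fst p), tag PY (snd p)))\<bar> \<le> \<omega>"
  proof (rule abs_integral_step_le)
    show "prob_space P" by fact
    show "finite (idx PX \<times> idx PY)" using PX PY by (auto simp: h_partition_def)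
    show "disjoint_family_on C (idx PX \<times> idx PY)"
      unfolding disjoint_family_on_def C_def
      using h_partition_cell_inj[OF PX] h_partition_cell_inj[OF PY] by fastforce
    show "space P \<subseteq> (\<Union>p\<in>idx PX \<times> idx PY. C p)"
    proof
      fix z
      obtain i where "i \<in> idx PX" "X z \<in> cell PX i" using h_partition_obtain_cell[OF PX] .
      moreover obtain j where "j \<in> idx PY" "Y z \<in> cell PY j" using h_partition_obtain_cell[OF PY] .
      ultimately show "z \<in> (\<Union>p\<in>idx PX \<times> idx PY. C p)" by (auto simp: C_def)
    qed
    show "integrable P (\<lambda>z. f (X z, Y z))"
      using integrable_continuous_compact[OF cXY f \<open>prob_space P\<close> XY] .
    show "\<bar>f (X z, Y z) - f (tag PX (fst p), tag PY (snd p))\<bar> \<le> \<omega>"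
      if "p \<in> idx PX \<times> idx PY" "z \<in> C p" for p z
      using that by (intro close h_partition_dist_tag[OF cX PX] h_partition_dist_tag[OF cY PY])
        (auto simp: C_def)
  qed (fact C)
  moreover have "(\<Sum>p\<in>idx PX \<times> idx PY. measure P (C p) * f (tag PX (fst p), tag PY (snd p))) =
      tag_cost PX PY w f"
    unfolding tag_cost_def by (rule sum.cong) (auto simp: C_def w)
  ultimately show ?thesis by simp
qed

lemma uniformly_continuous_product:
  fixes f :: "'a::metric_space \<times> 'b::metric_space \<Rightarrow> real"
  assumes "compact (UNIV :: 'a set)" "compact (UNIV :: 'b set)" "continuous_on UNIV f" "0 < e"
  obtains d where "0 < d"
    "\<And>x x' y y'. dist x x' \<le> d \<Longrightarrow> dist y y' \<le> d \<Longrightarrow> \<bar>f (x, y) - f (x', y')\<bar> \<le> e"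
proof -
  have "compact (UNIV :: ('a \<times> 'b) set)" using compact_Times[OF assms(1,2)] by simp
  then have "uniformly_continuous_on UNIV f" using assms(3) by (rule compact_uniformly_continuous[rotated])
  then obtain d where d: "0 < d" "\<And>p q. dist p q < d \<Longrightarrow> dist (f p) (f q) < e"
    unfolding uniformly_continuous_on_def using \<open>0 < e\<close> by (metis UNIV_I)
  show thesis
  proof
    \<comment> \<open>Two non-strict bounds by \<open>d / 3\<close> add up to strictly less than
      \<open>d\<close>; the bounds are non-strict since the cells have diameter at most
      \<open>h\<close>.\<close>
    show "0 < d / 3" using d(1) by simp
    fix x x' :: 'a and y y' :: 'b assume "dist x x' \<le> d / 3" "dist y y' \<le> d / 3"
    moreover have "dist (x, y) (x', y') \<le> dist x x' + dist y y'"
      unfolding dist_Pair_Pair by (rule sqrt_sum_squares_le_sum) auto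
    ultimately have "dist (x, y) (x', y') < d" using d(1) by linarith
    from d(2)[OF this] show "\<bar>f (x, y) - f (x', y')\<bar> \<le> e" by (simp add: dist_real_def)
  qed
qed

lemma tag_cost_tendsto:
  fixes f :: "'a::metric_space \<times> 'b::metric_space \<Rightarrow> real" and P :: "nat \<Rightarrow> 'z::metric_space measure"
  assumes cX: "compact (UNIV :: 'a set)" and cY: "compact (UNIV :: 'b set)"
    and f: "continuous_on UNIV f"
    and P: "\<And>k. prob_space (P k)" "\<And>k. sets (P k) = sets borel"
    and XY: "X \<in> borel_measurable borel" "Y \<in> borel_measurable borel"
    and PX: "\<And>k. h_partition (h k) (PX k)" and PY: "\<And>k. h_partition (h k) (PY k)"
    and w: "\<And>k i j. i \<in> idx (PX k) \<Longrightarrow> j \<in> idx (PY k) \<Longrightarrow>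
      measure (P k) {z. X z \<in> cell (PX k) i \<and> Y z \<in> cell (PY k) j} = w k i j"
    and h: "h \<longlonglongrightarrow> 0"
  shows "(\<lambda>k. (\<integral>z. f (X z, Y z) \<partial>P k) - tag_cost (PX k) (PY k) (w k) f) \<longlonglongrightarrow> 0"
proof (rule tendstoI)
  fix e :: real assume "0 < e"
  then have "0 < e / 2" by simp
  obtain d where d: "0 < d"
    "\<And>x x' y y'. dist x x' \<le> d \<Longrightarrow> dist y y' \<le> d \<Longrightarrow> \<bar>f (x, y) - f (x', y')\<bar> \<le> e / 2"
    using uniformly_continuous_product[OF cX cY f \<open>0 < e / 2\<close>] by metis
  have "eventually (\<lambda>k. h k < d) sequentially" using order_tendstoD(2)[OF h d(1)] .
  then show "eventually (\<lambda>k. dist ((\<integral>z. f (X z, Y z) \<partial>P k) - tag_cost (PX k) (PY k) (w k) f) 0 < e)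
      sequentially"
  proof eventually_elim
    case (elim k)
    have "\<bar>(\<integral>z. f (X z, Y z) \<partial>P k) - tag_cost (PX k) (PY k) (w k) f\<bar> \<le> e / 2"
      by (rule tag_cost_approx[OF cX cY f P XY PX PY w]) (use d(2) elim in auto)
    then show ?case using \<open>0 < e\<close> by (simp add: dist_real_def)
  qed
qed

text \<open>This makes a transport plan, in particular the optimal one, a competitor in the discrete
  problem for any given pair of partitions. The row and column sums are additivity over cells that
  cover the space disjointly.\<close>

lemma transport_plan_cells:
  fixes \<mu> :: "'a::metric_space measure" and \<nu> :: "'b::metric_space measure"
  assumes \<pi>: "\<pi> \<in> transport_plans \<mu> \<nu>" and PX: "h_partition h PX" and PY: "h_partition h PY"
  shows "h_plan \<mu> \<nu> h PX PY (\<lambda>i j. measure \<pi> {z. fst z \<in> cell PX i \<and> snd z \<in> cell PY j})"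
proof -
  interpret prob_space \<pi> using \<pi> by (simp add: transport_plans_def)
  have sets_pi[measurable_cong]: "sets \<pi> = sets borel" using \<pi> by (simp add: transport_plans_def)
  have sp: "space \<pi> = UNIV" using sets_eq_imp_space_eq[OF sets_pi] by simp
  have [measurable]: "(fst :: 'a \<times> 'b \<Rightarrow> 'a) \<in> borel_measurable borel"
    "(snd :: 'a \<times> 'b \<Rightarrow> 'b) \<in> borel_measurable borel"
    by (intro borel_measurable_continuous_onI continuous_intros)+
  have mu: "\<mu> = distr \<pi> borel fst" and nu: "\<nu> = distr \<pi> borel snd"
    using \<pi> by (auto simp: transport_plans_def)
  have meas: "{z. fst z \<in> cell PX i \<and> snd z \<in> cell PY j} \<in> sets \<pi>"
    if "i \<in> idx PX" "j \<in> idx PY" for i j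
  proof -
    have [measurable]: "cell PX i \<in> sets borel" "cell PY j \<in> sets borel"
      using that PX PY by (auto simp: h_partition_def)
    have "{z \<in> space \<pi>. fst z \<in> cell PX i \<and> snd z \<in> cell PY j} \<in> sets \<pi>" by measurable
    then show ?thesis by (simp add: sp)
  qed
  have row: "(\<Sum>j\<in>idx PY. measure \<pi> {z. fst z \<in> cell PX i \<and> snd z \<in> cell PY j}) = measure \<mu> (cell PX i)"
    if i: "i \<in> idx PX" for i
  proof -
    have "(\<Sum>j\<in>idx PY. measure \<pi> {z. fst z \<in> cell PX i \<and> snd z \<in> cell PY j}) =
        measure \<pi> (\<Union>j\<in>idx PY. {z. fst z \<in> cell PX i \<and> snd z \<in> cell PY j})"
      using PY meas i h_partition_cell_inj[OF PY]
      by (intro finite_measure_finite_Union[symmetric])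
        (auto simp: h_partition_def disjoint_family_on_def)
    also have "(\<Union>j\<in>idx PY. {z. fst z \<in> cell PX i \<and> snd z \<in> cell PY j}) = fst -` cell PX i \<inter> space \<pi>"
      using PY unfolding sp by (auto simp: h_partition_def)
    also have "measure \<pi> \<dots> = measure \<mu> (cell PX i)"
      using PX i unfolding mu by (subst measure_distr) (auto simp: h_partition_def)
    finally show ?thesis .
  qed
  have col: "(\<Sum>i\<in>idx PX. measure \<pi> {z. fst z \<in> cell PX i \<and> snd z \<in> cell PY j}) = measure \<nu> (cell PY j)"
    if j: "j \<in> idx PY" for j
  proof -
    have "(\<Sum>i\<in>idx PX. measure \<pi> {z. fst z \<in> cell PX i \<and> snd z \<in> cell PY j}) =
        measure \<pi> (\<Union>i\<in>idx PX. {z. fst z \<in> cell PX i \<and> snd z \<in> cell PY j})"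
      using PX meas j h_partition_cell_inj[OF PX]
      by (intro finite_measure_finite_Union[symmetric])
        (auto simp: h_partition_def disjoint_family_on_def)
    also have "(\<Union>i\<in>idx PX. {z. fst z \<in> cell PX i \<and> snd z \<in> cell PY j}) = snd -` cell PY j \<inter> space \<pi>"
      using PX unfolding sp by (auto simp: h_partition_def)
    also have "measure \<pi> \<dots> = measure \<nu> (cell PY j)"
      using PY j unfolding nu by (subst measure_distr) (auto simp: h_partition_def)
    finally show ?thesis .
  qed
  show ?thesis using PX PY row col by (simp add: h_plan_def)
qed

text \<open>A function of \<open>y\<close> alone sees only the column sums. Hence all h-plans on the
  same partitions give it the same value, which is what identifies the second marginal of the weak
  limit.\<close>

lemma tag_cost_snd:
  assumes "h_plan \<mu> \<nu> h PX PY w"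
  shows "tag_cost PX PY w (\<lambda>z. \<phi> (snd z)) = (\<Sum>j\<in>idx PY. measure \<nu> (cell PY j) * \<phi> (tag PY j))"
proof -
  have "tag_cost PX PY w (\<lambda>z. \<phi> (snd z)) = (\<Sum>i\<in>idx PX. \<Sum>j\<in>idx PY. w i j * \<phi> (tag PY j))"
    unfolding tag_cost_def by (simp add: sum.cartesian_product)
  also have "\<dots> = (\<Sum>j\<in>idx PY. \<Sum>i\<in>idx PX. w i j * \<phi> (tag PY j))" by (rule sum.swap)
  also have "\<dots> = (\<Sum>j\<in>idx PY. measure \<nu> (cell PY j) * \<phi> (tag PY j))"
    using assms by (intro sum.cong) (auto simp: h_plan_def sum_distrib_right[symmetric])
  finally show ?thesis .
qed

section \<open>Convergence to the optimal map\<close>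

text \<open>The graph is the zero set of the Borel function \<open>dist (S x) y\<close>, hence
  measurable, so the claim can be pulled back to \<open>\<mu>\<close>, where it is trivial.\<close>

lemma AE_induced_plan_graph:
  fixes S :: "'a::metric_space \<Rightarrow> 'b::metric_space"
  assumes cX: "compact (UNIV :: 'a set)" and cY: "compact (UNIV :: 'b set)"
    and [measurable_cong]: "sets \<mu> = sets borel"
    and S[measurable]: "S \<in> borel_measurable borel"
  shows "AE z in induced_plan \<mu> S. S (fst z) = snd z"
proof -
  have [measurable]: "(fst :: 'a \<times> 'b \<Rightarrow> 'a) \<in> borel_measurable borel"
    "(snd :: 'a \<times> 'b \<Rightarrow> 'b) \<in> borel_measurable borel"
    by (intro borel_measurable_continuous_onI continuous_intros)+
  have [measurable]: "(\<lambda>z :: 'a \<times> 'b. dist (S (fst z)) (snd z)) \<in> borel_measurable borel"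
    by (rule borel_measurable_dist_compact[OF cY]) measurable
  have [measurable]: "(\<lambda>x. (x, S x)) \<in> borel_measurable \<mu>"
    by (intro borel_measurable_Pair_compact cX cY) measurable
  have "{z \<in> space borel. dist (S (fst z)) (snd z) = 0} \<in> sets borel" by measurable
  then have "AE z in induced_plan \<mu> S. dist (S (fst z)) (snd z) = 0"
    unfolding induced_plan_def by (subst AE_distr_iff) auto
  then show ?thesis by simp
qed

section \<open>Weak limits of almost optimal plans\<close>

text \<open>Compactness yields a limit only along a subsequence. Applied to every subsequence of the
  original data, this still gives convergence of the full sequence.\<close>

lemma eps_optimal_plans_subseq_to_graph:
  fixes \<mu> :: "'a::metric_space measure" and \<nu> :: "'b::metric_space measure" and S :: "'a \<Rightarrow> 'b"
  assumes OT: "compact_OT_problem \<mu> \<nu> c"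
    and S[measurable]: "S \<in> borel_measurable borel"
    and opt: "optimal_plan c \<mu> \<nu> (induced_plan \<mu> S)"
    and unique: "\<And>\<pi>. optimal_plan c \<mu> \<nu> \<pi> \<Longrightarrow> \<pi> = induced_plan \<mu> S"
    and eps: "\<And>k. eps_optimal_h_plan c \<mu> \<nu> (\<epsilon> k) (h k) (PX k) (PY k) (w k)"
    and \<epsilon>: "\<epsilon> \<longlonglongrightarrow> 0" and h: "h \<longlonglongrightarrow> 0"
  obtains r where "strict_mono r"
    "(\<lambda>k. \<integral>x. (\<Sum>j\<in>idx (PY (r k)).
        cell_weight \<mu> (PX (r k)) (w (r k)) j x * dist (S x) (tag (PY (r k)) j)) \<partial>\<mu>) \<longlonglongrightarrow> 0"
proof -
  have cX: "compact (UNIV :: 'a set)" and cY: "compact (UNIV :: 'b set)"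
    and pmu: "prob_space \<mu>" and sets_mu[measurable_cong]: "sets \<mu> = sets borel"
    and pnu: "prob_space \<nu>" and sets_nu[measurable_cong]: "sets \<nu> = sets borel"
    and c: "continuous_on UNIV c"
    using OT by (auto simp: compact_OT_problem_def)
  have cYY: "compact (UNIV :: ('b \<times> 'b) set)" using compact_Times[OF cY cY] by simp
  have cZ: "compact (UNIV :: ('a \<times> 'b \<times> 'b) set)" using compact_Times[OF cX cYY] by simp
  define \<pi> where "\<pi> = induced_plan \<mu> S"
  have \<pi>: "\<pi> \<in> transport_plans \<mu> \<nu>" using opt by (simp add: optimal_plan_def \<pi>_def)
  then have p_pi: "prob_space \<pi>" and sets_pi[measurable_cong]: "sets \<pi> = sets borel"
    and pi_fst: "distr \<pi> borel fst = \<mu>" and pi_snd: "distr \<pi> borel snd = \<nu>"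
    by (auto simp: transport_plans_def)
  have plan: "h_plan \<mu> \<nu> (h k) (PX k) (PY k) (w k)" for k
    using eps[of k] by (simp add: eps_optimal_h_plan_def)
  have PX: "h_partition (h k) (PX k)" and PY: "h_partition (h k) (PY k)" for k
    using plan[of k] by (auto simp: h_plan_def)
  define W where "W k = cell_weight \<mu> (PX k) (w k)" for k
  \<comment> \<open>All properties of the glued law are bundled so that a single choice of
    \<open>M k\<close> satisfies them together.\<close>
  define glued where "glued k M \<longleftrightarrow> prob_space M \<and> sets M = sets borel \<and>
      (\<forall>f :: 'a \<times> 'b \<times> 'b \<Rightarrow> real. continuous_on UNIV f \<longrightarrow>
        (\<integral>z. f z \<partial>M) = (\<integral>x. (\<Sum>j\<in>idx (PY k). W k j x * f (x, S x, tag (PY k) j)) \<partial>\<mu>)) \<and>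
      (\<forall>f :: 'a \<times> 'b \<Rightarrow> real. continuous_on UNIV f \<longrightarrow>
        (\<integral>z. f (fst z, fst (snd z)) \<partial>M) = (\<integral>x. f (x, S x) \<partial>\<mu>)) \<and>
      (\<forall>i\<in>idx (PX k). \<forall>j\<in>idx (PY k).
        measure M {z. fst z \<in> cell (PX k) i \<and> snd (snd z) \<in> cell (PY k) j} = w k i j)" for k M
  have "\<exists>M. glued k M" for k
    by (rule glued_plan[OF cX cY pmu sets_mu S plan[of k]]) (unfold W_def glued_def, blast)
  then obtain M where glued: "\<And>k. glued k (M k)" by metis
  have pM: "prob_space (M k)" and sets_M[measurable_cong]: "sets (M k) = sets borel" for k
    using glued[of k] by (simp_all add: glued_def)
  have int_M: "(\<integral>z. f z \<partial>M k) = (\<integral>x. (\<Sum>j\<in>idx (PY k). W k j x * f (x, S x, tag (PY k) j)) \<partial>\<mu>)"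
    if "continuous_on UNIV f" for f :: "_ \<Rightarrow> real" and k
    using glued[of k] that unfolding glued_def by blast
  have marg_M: "(\<integral>z. f (fst z, fst (snd z)) \<partial>M k) = (\<integral>x. f (x, S x) \<partial>\<mu>)"
    if "continuous_on UNIV f" for f :: "_ \<Rightarrow> real" and k
    using glued[of k] that unfolding glued_def by blast
  have cells_M: "measure (M k) {z. fst z \<in> cell (PX k) i \<and> snd (snd z) \<in> cell (PY k) j} = w k i j"
    if "i \<in> idx (PX k)" "j \<in> idx (PY k)" for i j k
    using glued[of k] that unfolding glued_def by blast
  obtain r N where r: "strict_mono r" and pN: "prob_space N" and sets_N[measurable_cong]: "sets N = sets borel"
    and lim: "\<And>f :: 'a \<times> 'b \<times> 'b \<Rightarrow> real. continuous_on UNIV f \<Longrightarrow>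
      (\<lambda>n. \<integral>z. f z \<partial>M (r n)) \<longlonglongrightarrow> (\<integral>z. f z \<partial>N)"
    using compact_prob_weak_limit[OF cZ, of M] pM sets_M by blast
  interpret N: prob_space N by (rule pN)
  have m[measurable]: "(fst :: 'a \<times> 'b \<Rightarrow> 'a) \<in> borel_measurable borel"
    "(snd :: 'a \<times> 'b \<Rightarrow> 'b) \<in> borel_measurable borel"
    "(\<lambda>z :: 'a \<times> 'b \<times> 'b. fst z) \<in> borel_measurable borel"
    "(\<lambda>z :: 'a \<times> 'b \<times> 'b. snd (snd z)) \<in> borel_measurable borel"
    "(\<lambda>z :: 'a \<times> 'b \<times> 'b. (fst z, fst (snd z))) \<in> borel_measurable borel"
    "(\<lambda>z :: 'a \<times> 'b \<times> 'b. (fst z, snd (snd z))) \<in> borel_measurable borel"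
    by (intro borel_measurable_continuous_onI continuous_intros)+
  have mS[measurable]: "(\<lambda>x. (x, S x)) \<in> borel_measurable \<mu>"
    by (intro borel_measurable_Pair_compact cX cY) measurable
  have lim12: "(\<lambda>n. \<integral>z. f (fst z, fst (snd z)) \<partial>M (r n)) \<longlonglongrightarrow> (\<integral>z. f (fst z, fst (snd z)) \<partial>N)"
    and lim13: "(\<lambda>n. \<integral>z. f (fst z, snd (snd z)) \<partial>M (r n)) \<longlonglongrightarrow> (\<integral>z. f (fst z, snd (snd z)) \<partial>N)"
    if f: "continuous_on UNIV f" for f :: "'a \<times> 'b \<Rightarrow> real"
    by (intro lim continuous_on_compose2[OF f] continuous_intros; simp)+
  have marg_N: "(\<integral>z. f (fst z, fst (snd z)) \<partial>N) = (\<integral>x. f (x, S x) \<partial>\<mu>)"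
    if f: "continuous_on UNIV f" for f :: "'a \<times> 'b \<Rightarrow> real"
    using lim12[OF f] by (simp add: marg_M[OF f] LIMSEQ_const_iff)
  \<comment> \<open>The law of the first two coordinates is the same for every k, so the weak limit
    inherits it.\<close>
  have N12: "distr N borel (\<lambda>z. (fst z, fst (snd z))) = \<pi>"
  proof (rule measure_eqI_continuous)
    show "finite_measure (distr N borel (\<lambda>z. (fst z, fst (snd z))))"
      by (rule N.finite_measure_distr) measurable
    show "finite_measure \<pi>" using p_pi by (rule prob_space.finite_measure)
    fix f :: "'a \<times> 'b \<Rightarrow> real" assume f: "continuous_on UNIV f"
    then have [measurable]: "f \<in> borel_measurable borel" by (rule borel_measurable_continuous_onI)
    show "(\<integral>z. f z \<partial>distr N borel (\<lambda>z. (fst z, fst (snd z)))) = (\<integral>z. f z \<partial>\<pi>)"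
      unfolding \<pi>_def induced_plan_def by (simp add: integral_distr marg_N[OF f])
  qed (simp_all add: sets_pi)
  \<comment> \<open>The optimal plan discretized on the k-th partitions, the competitor for
    \<open>w k\<close>.\<close>
  define w' where "w' k i j = measure \<pi> {z. fst z \<in> cell (PX k) i \<and> snd z \<in> cell (PY k) j}" for k i j
  have plan': "h_plan \<mu> \<nu> (h k) (PX k) (PY k) (w' k)" for k
    unfolding w'_def by (rule transport_plan_cells[OF \<pi> PX PY])
  have dev: "(\<lambda>k. (\<integral>z. f (fst z, snd (snd z)) \<partial>M k) - tag_cost (PX k) (PY k) (w k) f) \<longlonglongrightarrow> 0"
    if f: "continuous_on UNIV f" for f :: "'a \<times> 'b \<Rightarrow> real"
    by (rule tag_cost_tendsto[OF cX cY f pM sets_M m(3,4) PX PY cells_M h])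
  have dev': "(\<lambda>k. (\<integral>z. f z \<partial>\<pi>) - tag_cost (PX k) (PY k) (w' k) f) \<longlonglongrightarrow> 0"
    if f: "continuous_on UNIV f" for f :: "'a \<times> 'b \<Rightarrow> real"
    using tag_cost_tendsto[OF cX cY f p_pi sets_pi m(1,2) PX PY w'_def[symmetric] h] by simp
  define \<sigma> where "\<sigma> = distr N borel (\<lambda>z. (fst z, snd (snd z)))"
  have int_\<sigma>: "(\<integral>z. f z \<partial>\<sigma>) = (\<integral>z. f (fst z, snd (snd z)) \<partial>N)"
    if f: "continuous_on UNIV f" for f :: "'a \<times> 'b \<Rightarrow> real"
    unfolding \<sigma>_def using borel_measurable_continuous_onI[OF f] by (simp add: integral_distr)
  have \<sigma>_fst: "distr \<sigma> borel fst = \<mu>"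
  proof (rule measure_eqI_continuous)
    show "finite_measure (distr \<sigma> borel fst)"
      unfolding \<sigma>_def by (subst distr_distr) (auto intro!: N.finite_measure_distr simp: o_def)
    show "finite_measure \<mu>" using pmu by (rule prob_space.finite_measure)
    fix f :: "'a \<Rightarrow> real" assume f: "continuous_on UNIV f"
    then have [measurable]: "f \<in> borel_measurable borel" by (rule borel_measurable_continuous_onI)
    have f1: "continuous_on UNIV (\<lambda>z :: 'a \<times> 'b. f (fst z))"
      by (intro continuous_on_compose2[OF f] continuous_intros) simp
    \<comment> \<open>A test function of the first coordinate does not notice whether the second or
      the third coordinate is kept, so the formula for the first two applies.\<close>
    have "(\<integral>x. f x \<partial>distr \<sigma> borel fst) = (\<integral>z. f (fst z) \<partial>\<sigma>)"
      by (rule integral_distr) (auto simp: \<sigma>_def)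
    also have "\<dots> = (\<integral>x. f x \<partial>\<mu>)" using int_\<sigma>[OF f1] marg_N[OF f1] by simp
    finally show "(\<integral>x. f x \<partial>distr \<sigma> borel fst) = (\<integral>x. f x \<partial>\<mu>)" .
  qed (simp_all add: sets_mu)
  have \<sigma>_snd: "distr \<sigma> borel snd = \<nu>"
  proof (rule measure_eqI_continuous)
    show "finite_measure (distr \<sigma> borel snd)"
      unfolding \<sigma>_def by (subst distr_distr) (auto intro!: N.finite_measure_distr simp: o_def)
    show "finite_measure \<nu>" using pnu by (rule prob_space.finite_measure)
    fix f :: "'b \<Rightarrow> real" assume f: "continuous_on UNIV f"
    then have [measurable]: "f \<in> borel_measurable borel" by (rule borel_measurable_continuous_onI)
    have f2: "continuous_on UNIV (\<lambda>z :: 'a \<times> 'b. f (snd z))"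
      by (intro continuous_on_compose2[OF f] continuous_intros) simp
    \<comment> \<open>For a function of \<open>y\<close> alone the discrete sums of
      \<open>w k\<close> and \<open>w' k\<close> coincide, so they cancel in the difference of the
      two approximations.\<close>
    have "(\<lambda>k. (\<integral>z. f (snd (snd z)) \<partial>M k) - (\<integral>z. f (snd z) \<partial>\<pi>)) \<longlonglongrightarrow> 0 - 0"
      using tendsto_diff[OF dev[OF f2] dev'[OF f2]]
      by (simp add: tag_cost_snd[OF plan] tag_cost_snd[OF plan'])
    then have "(\<lambda>k. \<integral>z. f (snd (snd z)) \<partial>M k) \<longlonglongrightarrow> (\<integral>z. f (snd z) \<partial>\<pi>)"
      by (simp add: LIM_zero_iff)
    from LIMSEQ_subseq_LIMSEQ[OF this r]
    have "(\<lambda>n. \<integral>z. f (snd (snd z)) \<partial>M (r n)) \<longlonglongrightarrow> (\<integral>z. f (snd z) \<partial>\<pi>)" by (simp add: o_def)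
    moreover have "(\<lambda>n. \<integral>z. f (snd (snd z)) \<partial>M (r n)) \<longlonglongrightarrow> (\<integral>z. f (snd (snd z)) \<partial>N)"
      using lim13[OF f2] by simp
    ultimately have "(\<integral>z. f (snd (snd z)) \<partial>N) = (\<integral>z. f (snd z) \<partial>\<pi>)" by (rule LIMSEQ_unique[rotated])
    moreover have "(\<integral>y. f y \<partial>distr \<sigma> borel snd) = (\<integral>z. f (snd z) \<partial>\<sigma>)"
      by (rule integral_distr) (auto simp: \<sigma>_def)
    moreover have "(\<integral>y. f y \<partial>\<nu>) = (\<integral>z. f (snd z) \<partial>\<pi>)"
      unfolding pi_snd[symmetric] by (rule integral_distr) auto
    ultimately show "(\<integral>y. f y \<partial>distr \<sigma> borel snd) = (\<integral>y. f y \<partial>\<nu>)"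
      using int_\<sigma>[OF f2] by simp
  qed (simp_all add: sets_nu)
  have \<sigma>: "\<sigma> \<in> transport_plans \<mu> \<nu>"
    using \<sigma>_fst \<sigma>_snd unfolding transport_plans_def \<sigma>_def by (auto intro!: N.prob_space_distr)
  have "transport_cost c \<sigma> \<le> transport_cost c \<pi>"
  proof -
    have le: "tag_cost (PX k) (PY k) (w k) c \<le> \<epsilon> k + tag_cost (PX k) (PY k) (w' k) c" for k
      using eps[of k] plan' unfolding eps_optimal_h_plan_def
      by (metis transport_cost_plan_measure[OF plan c] transport_cost_plan_measure[OF plan' c])
    \<comment> \<open>After cancellation this expression is the cost integral under
      \<open>M k\<close> plus \<open>\<epsilon> k\<close> plus the discrete cost of
      \<open>w' k\<close> minus that of \<open>w k\<close>. By almost optimality it bounds the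
      integral under \<open>M k\<close> from above, and it tends to the cost of
      \<open>\<pi>\<close>.\<close>
    have "(\<lambda>k. ((\<integral>z. c (fst z, snd (snd z)) \<partial>M k) - tag_cost (PX k) (PY k) (w k) c) + \<epsilon> k -
        ((\<integral>z. c z \<partial>\<pi>) - tag_cost (PX k) (PY k) (w' k) c) + (\<integral>z. c z \<partial>\<pi>)) \<longlonglongrightarrow>
        0 + 0 - 0 + (\<integral>z. c z \<partial>\<pi>)"
      by (intro tendsto_add tendsto_diff dev[OF c] dev'[OF c] \<epsilon> tendsto_const)
    from LIMSEQ_subseq_LIMSEQ[OF this r] have "(\<integral>z. c (fst z, snd (snd z)) \<partial>N) \<le> 0 + 0 - 0 + (\<integral>z. c z \<partial>\<pi>)"
    proof (rule LIMSEQ_le[OF lim13[OF c]], intro exI allI impI)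
      fix n
      show "(\<integral>z. c (fst z, snd (snd z)) \<partial>M (r n)) \<le>
        ((\<lambda>k. ((\<integral>z. c (fst z, snd (snd z)) \<partial>M k) - tag_cost (PX k) (PY k) (w k) c) + \<epsilon> k -
        ((\<integral>z. c z \<partial>\<pi>) - tag_cost (PX k) (PY k) (w' k) c) + (\<integral>z. c z \<partial>\<pi>)) \<circ> r) n"
        using le[of "r n"] by simp
    qed
    then show ?thesis by (simp add: transport_cost_def int_\<sigma>[OF c])
  qed
  then have "optimal_plan c \<mu> \<nu> \<sigma>"
    using \<sigma> opt unfolding optimal_plan_def \<pi>_def by (meson order_trans)
  then have N13: "\<sigma> = \<pi>" unfolding \<pi>_def by (rule unique)
  have graph: "AE z in \<pi>. S (fst z) = snd z"
    unfolding \<pi>_def by (rule AE_induced_plan_graph[OF cX cY sets_mu S])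
  \<comment> \<open>Both pairs of coordinates have law \<open>\<pi>\<close>, so the graph property
    pulls back to \<open>N\<close> twice, with the same first coordinate.\<close>
  have "AE z in N. S (fst z) = fst (snd z)"
    using AE_distrD[OF _ graph[folded N12]] by simp
  moreover have "AE z in N. S (fst z) = snd (snd z)"
    using AE_distrD[OF _ graph[folded N13, unfolded \<sigma>_def]] by simp
  ultimately have "AE z in N. dist (fst (snd z)) (snd (snd z)) = 0"
    by eventually_elim simp
  then have "(\<integral>z. dist (fst (snd z)) (snd (snd z)) \<partial>N) = 0"
    by (rule integral_eq_zero_AE)
  moreover have cd: "continuous_on UNIV (\<lambda>z :: 'a \<times> 'b \<times> 'b. dist (fst (snd z)) (snd (snd z)))"
    by (intro continuous_intros)
  ultimately have "(\<lambda>n. \<integral>z. dist (fst (snd z)) (snd (snd z)) \<partial>M (r n)) \<longlonglongrightarrow> 0"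
    using lim[OF cd] by simp
  then have "(\<lambda>k. \<integral>x. (\<Sum>j\<in>idx (PY (r k)). W (r k) j x * dist (S x) (tag (PY (r k)) j)) \<partial>\<mu>) \<longlonglongrightarrow> 0"
    by (simp add: int_M[OF cd])
  then show thesis using that[OF r] by (simp add: W_def)
qed

section \<open>From plans to projection maps\<close>

text \<open>Otherwise some subsequence would stay at distance at least \<open>e\<close> from
  \<open>L\<close>, and so would each of its own subsequences.\<close>

lemma tendsto_if_all_subseq:
  fixes X :: "nat \<Rightarrow> 'a::metric_space"
  assumes "\<And>s. strict_mono (s :: nat \<Rightarrow> nat) \<Longrightarrow> \<exists>r. strict_mono r \<and> (\<lambda>k. X (s (r k))) \<longlonglongrightarrow> L"
  shows "X \<longlonglongrightarrow> L"
proof (rule tendstoI, rule ccontr)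
  fix e :: real assume "0 < e" and "\<not> eventually (\<lambda>k. dist (X k) L < e) sequentially"
  then obtain s :: "nat \<Rightarrow> nat" where s: "strict_mono s" "\<And>k. \<not> dist (X (s k)) L < e"
    using not_eventually_sequentiallyD by blast
  obtain r :: "nat \<Rightarrow> nat" where "(\<lambda>k. X (s (r k))) \<longlonglongrightarrow> L" using assms[OF s(1)] by blast
  then have "eventually (\<lambda>k. dist (X (s (r k))) L < e) sequentially"
    using \<open>0 < e\<close> by (rule tendstoD)
  then show False using s(2) by simp
qed

text \<open>For a median, the triangle inequality through \<open>tag PY j\<close> is averaged over
  j, and the mean distance from \<open>T x\<close> is compared with that from \<open>y\<close> by
  taking \<open>y\<close> as competitor. For a barycenter, convexity of the norm gives the bound
  even with factor 1 and no error. The point \<open>y\<close> is arbitrary; it will be the value of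
  the optimal map at \<open>x\<close>.\<close>

lemma projection_map_dist_le:
  fixes \<mu> :: "'a::metric_space measure" and \<nu> :: "'b::metric_space measure"
    and \<iota> :: "'b \<Rightarrow> 'v::real_normed_vector"
  assumes plan: "h_plan \<mu> \<nu> h PX PY w" and T: "T \<in> projection_maps \<iota> Q \<mu> h PX PY w" and "0 \<le> Q"
    and i: "i \<in> idx PX" "x \<in> cell PX i" "0 < measure \<mu> (cell PX i)"
  shows "dist (T x) y \<le> 2 * (\<Sum>j\<in>idx PY. cell_weight \<mu> PX w j x * dist y (tag PY j)) + Q * h"
proof -
  have PX: "h_partition h PX" using plan by (simp add: h_plan_def)
  then have "0 \<le> h" by (simp add: h_partition_def)
  define v where "v j = w i j / measure \<mu> (cell PX i)" for j
  have v: "cell_weight \<mu> PX w j x = v j" for j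
    unfolding v_def by (rule cell_weight_eq[OF PX i(1,2)])
  have v0: "0 \<le> v j" if "j \<in> idx PY" for j
    using cell_weight_bounds(1)[OF plan that] v by metis
  have v1: "(\<Sum>j\<in>idx PY. v j) = 1"
    using cell_weight_sum[OF plan i] v by simp
  consider "T \<in> projection_maps_GM Q \<mu> h PX PY w" | "T \<in> projection_maps_B \<iota> \<mu> PX PY w"
    using T by (auto simp: projection_maps_def)
  then show ?thesis
    unfolding v
  proof cases
    case 1
    then have med: "approx_geometric_median (Q * h) (idx PY) (tag PY) v (T x)"
      using i unfolding projection_maps_GM_def v_def by auto
    have "dist (T x) y = (\<Sum>j\<in>idx PY. v j * dist (T x) y)"
      by (simp add: v1 flip: sum_distrib_right)
    also have "\<dots> \<le> (\<Sum>j\<in>idx PY. v j * dist (T x) (tag PY j) + v j * dist y (tag PY j))"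
      using v0 by (intro sum_mono) (auto simp flip: distrib_left intro!: mult_left_mono dist_triangle2)
    also have "\<dots> \<le> 2 * (\<Sum>j\<in>idx PY. v j * dist y (tag PY j)) + Q * h"
      using med unfolding approx_geometric_median_def by (simp add: sum.distrib)
    finally show "dist (T x) y \<le> 2 * (\<Sum>j\<in>idx PY. v j * dist y (tag PY j)) + Q * h" .
  next
    case 2
    then have n: "dist y y' = norm (\<iota> y - \<iota> y')" for y y'
      by (auto simp: projection_maps_B_def normed_via_def)
    have "\<iota> (T x) = (\<Sum>j\<in>idx PY. v j *\<^sub>R \<iota> (tag PY j))"
      using 2 i unfolding projection_maps_B_def v_def by auto
    \<comment> \<open>The weights sum to 1, so \<open>\<iota> y\<close> can be distributed over the
      sum and absorbed into each term.\<close>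
    then have "\<iota> (T x) - \<iota> y = (\<Sum>j\<in>idx PY. v j *\<^sub>R \<iota> (tag PY j)) - (\<Sum>j\<in>idx PY. v j) *\<^sub>R \<iota> y"
      by (simp add: v1)
    also have "\<dots> = (\<Sum>j\<in>idx PY. v j *\<^sub>R (\<iota> (tag PY j) - \<iota> y))"
      by (simp add: scaleR_sum_left sum_subtractf scaleR_diff_right)
    also have "norm \<dots> \<le> (\<Sum>j\<in>idx PY. v j * dist y (tag PY j))"
      using v0 by (intro sum_norm_le) (auto simp: n norm_minus_commute)
    finally have "dist (T x) y \<le> (\<Sum>j\<in>idx PY. v j * dist y (tag PY j))" by (simp add: n)
    moreover have "0 \<le> (\<Sum>j\<in>idx PY. v j * dist y (tag PY j))" using v0 by (intro sum_nonneg) auto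
    moreover have "0 \<le> Q * h" using \<open>0 \<le> Q\<close> \<open>0 \<le> h\<close> by simp
    ultimately show "dist (T x) y \<le> 2 * (\<Sum>j\<in>idx PY. v j * dist y (tag PY j)) + Q * h" by linarith
  qed
qed

text \<open>With \<open>D\<close> the diameter of the target, the p-th power of a distance is at
  most \<open>D powr (p - 1)\<close> times the distance, since \<open>p - 1\<close> is nonnegative.
  Hence convergence in mean gives every finite exponent.\<close>

lemma map_dist_tendsto_if_L1:
  fixes T :: "nat \<Rightarrow> 'a \<Rightarrow> 'b::metric_space"
  assumes cY: "compact (UNIV :: 'b set)" and "prob_space \<mu>"
    and T[measurable]: "\<And>k. T k \<in> borel_measurable \<mu>" and S[measurable]: "S \<in> borel_measurable \<mu>"
    and L1: "(\<lambda>k. \<integral>x. dist (T k x) (S x) \<partial>\<mu>) \<longlonglongrightarrow> 0" and p: "1 \<le> p"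
  shows "(\<lambda>k. map_dist p \<mu> (T k) S) \<longlonglongrightarrow> 0"
proof -
  interpret prob_space \<mu> by fact
  have [measurable]: "(\<lambda>x. dist (T k x) (S x)) \<in> borel_measurable \<mu>" for k
    by (intro borel_measurable_dist_compact cY T S)
  define D where "D = diameter (UNIV :: 'b set)"
  have D: "dist y y' \<le> D" for y y' :: 'b
    unfolding D_def using compact_imp_bounded[OF cY] by (intro diameter_bounded_bound) auto
  have D0: "0 \<le> D" using D[of undefined undefined] by simp
  have le: "dist y y' powr p \<le> D powr (p - 1) * dist y y'" for y y' :: 'b
  proof (cases "y = y'")
    case False
    then have "dist y y' powr p = dist y y' powr (p - 1) * dist y y'"
      using powr_add[of "dist y y'" "p - 1" 1] by simp
    also have "\<dots> \<le> D powr (p - 1) * dist y y'"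
      using p D by (intro mult_right_mono powr_mono2) auto
    finally show ?thesis .
  qed simp
  have i1: "integrable \<mu> (\<lambda>x. dist (T k x) (S x))" for k
    using D by (intro integrable_const_bound[of _ D]) auto
  have ip: "integrable \<mu> (\<lambda>x. dist (T k x) (S x) powr p)" for k
    using D p by (intro integrable_const_bound[of _ "D powr p"]) (auto intro!: powr_mono2)
  have int_le: "(\<integral>x. dist (T k x) (S x) powr p \<partial>\<mu>) \<le> D powr (p - 1) * (\<integral>x. dist (T k x) (S x) \<partial>\<mu>)" for k
  proof -
    have "(\<integral>x. dist (T k x) (S x) powr p \<partial>\<mu>) \<le> (\<integral>x. D powr (p - 1) * dist (T k x) (S x) \<partial>\<mu>)"
      by (rule integral_mono) (use ip i1 le in auto)
    then show ?thesis by simp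
  qed
  have "(\<lambda>k. D powr (p - 1) * (\<integral>x. dist (T k x) (S x) \<partial>\<mu>)) \<longlonglongrightarrow> 0"
    using tendsto_mult_right_zero[OF L1] .
  then have "(\<lambda>k. \<integral>x. dist (T k x) (S x) powr p \<partial>\<mu>) \<longlonglongrightarrow> 0"
    by (rule tendsto_sandwich[OF always_eventually always_eventually tendsto_const, rotated 2])
      (auto simp: int_le)
  then show ?thesis
    unfolding map_dist_def using p by (intro tendsto_zero_powrI[of _ _ _ "1 / p"]) auto
qed

theorem theoremB:
  fixes \<mu> :: "'a::metric_space measure"
    and \<nu> :: "'b::metric_space measure"
    and c :: "'a \<times> 'b \<Rightarrow> real"
    and \<iota> :: "'b \<Rightarrow> 'v::real_normed_vector"
    and Tstar :: "'a \<Rightarrow> 'b"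
    and T :: "nat \<Rightarrow> 'a \<Rightarrow> 'b"
  assumes "compact_OT_problem \<mu> \<nu> c"
    and "strong_uniqueness c \<mu> \<nu>"
    and "optimal_map c \<mu> \<nu> Tstar"
    and "approximating_projection_maps \<iota> c \<mu> \<nu> T"
  shows "\<forall>p\<ge>1. (\<lambda>k. map_dist p \<mu> (T k) Tstar) \<longlonglongrightarrow> 0"
proof -
  have cX: "compact (UNIV :: 'a set)" and cY: "compact (UNIV :: 'b set)"
    and pmu: "prob_space \<mu>" and sets_mu[measurable_cong]: "sets \<mu> = sets borel"
    and c: "continuous_on UNIV c"
    using assms(1) by (auto simp: compact_OT_problem_def)
  interpret prob_space \<mu> by (rule pmu)
  have Tstar[measurable]: "Tstar \<in> borel_measurable borel" and Tstar_nu: "distr \<mu> borel Tstar = \<nu>"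
    using assms(3) by (auto simp: optimal_map_def transport_map_def)
  have cm[measurable]: "c \<in> borel_measurable borel" using c by (rule borel_measurable_continuous_onI)
  have graph[measurable]: "(\<lambda>x. (x, S x)) \<in> borel_measurable \<mu>"
    if [measurable]: "S \<in> borel_measurable borel" for S :: "'a \<Rightarrow> 'b"
    by (intro borel_measurable_Pair_compact cX cY) measurable
  have cost: "transport_cost c (induced_plan \<mu> S) = (\<integral>x. c (x, S x) \<partial>\<mu>)"
    if "S \<in> borel_measurable borel" for S :: "'a \<Rightarrow> 'b"
    unfolding transport_cost_def induced_plan_def by (rule integral_distr[OF graph[OF that] cm])
  obtain \<pi> where "optimal_plan c \<mu> \<nu> \<pi> \<and> (\<forall>\<pi>'. optimal_plan c \<mu> \<nu> \<pi>' \<longrightarrow> \<pi>' = \<pi>) \<and>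
      (\<exists>T. transport_map \<mu> \<nu> T \<and> induced_plan \<mu> T = \<pi>)"
    using assms(2) unfolding strong_uniqueness_def ..
  then have \<pi>: "optimal_plan c \<mu> \<nu> \<pi>" "\<And>\<pi>'. optimal_plan c \<mu> \<nu> \<pi>' \<Longrightarrow> \<pi>' = \<pi>"
    and "\<exists>T. transport_map \<mu> \<nu> T \<and> induced_plan \<mu> T = \<pi>" by blast+
  then obtain T0 where T0: "transport_map \<mu> \<nu> T0" "induced_plan \<mu> T0 = \<pi>" by blast
  have [measurable]: "(fst :: 'a \<times> 'b \<Rightarrow> 'a) \<in> borel_measurable borel"
    "(snd :: 'a \<times> 'b \<Rightarrow> 'b) \<in> borel_measurable borel"
    by (intro borel_measurable_continuous_onI continuous_intros)+
  have "induced_plan \<mu> Tstar \<in> transport_plans \<mu> \<nu>"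
  proof -
    have "distr \<mu> borel (\<lambda>x. x) = \<mu>" using distr_id2[OF sets_mu[symmetric]] by simp
    then show ?thesis
      using Tstar_nu graph[OF Tstar] unfolding transport_plans_def induced_plan_def
      by (auto simp: distr_distr o_def intro!: prob_space_distr)
  qed
  \<comment> \<open>Optimality of \<open>Tstar\<close> is only among maps, but the optimal plan
    \<open>\<pi>\<close> is induced by a map \<open>T0\<close>, which is such a competitor. So
    \<open>Tstar\<close> induces an optimal plan, and uniqueness identifies it with
    \<open>\<pi>\<close>.\<close>
  moreover have "transport_cost c (induced_plan \<mu> Tstar) \<le> transport_cost c \<pi>"
    using assms(3) T0 cost[OF Tstar] cost[of T0] by (auto simp: optimal_map_def transport_map_def)
  ultimately have opt: "optimal_plan c \<mu> \<nu> (induced_plan \<mu> Tstar)"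
    using \<pi>(1) unfolding optimal_plan_def by (meson order_trans)
  have unique: "\<pi>' = induced_plan \<mu> Tstar" if "optimal_plan c \<mu> \<nu> \<pi>'" for \<pi>'
    using \<pi>(2)[OF that] \<pi>(2)[OF opt] by simp
  obtain Q h PX PY w where Q: "0 \<le> Q"
    and "approximating_plans c \<mu> \<nu> h PX PY w"
    and T: "\<And>k. T k \<in> projection_maps \<iota> Q \<mu> (h k) (PX k) (PY k) (w k)"
    using assms(4) unfolding approximating_projection_maps_def by blast
  then obtain \<epsilon> where
    eps: "\<And>k. eps_optimal_h_plan c \<mu> \<nu> (\<epsilon> k) (h k) (PX k) (PY k) (w k)"
    and \<epsilon>: "\<epsilon> \<longlonglongrightarrow> 0" and h: "h \<longlonglongrightarrow> 0"
    unfolding approximating_plans_def by (elim exE conjE, intro that) auto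
  have plan: "h_plan \<mu> \<nu> (h k) (PX k) (PY k) (w k)" for k
    using eps[of k] by (simp add: eps_optimal_h_plan_def)
  have PX: "h_partition (h k) (PX k)" for k using plan[of k] by (simp add: h_plan_def)
  have T_meas[measurable]: "T k \<in> borel_measurable borel" for k
    using T[of k] by (auto simp: projection_maps_def projection_maps_GM_def projection_maps_B_def)
  define V where "V k x = (\<Sum>j\<in>idx (PY k). cell_weight \<mu> (PX k) (w k) j x * dist (Tstar x) (tag (PY k) j))" for k x
  have V0: "(\<lambda>k. \<integral>x. V k x \<partial>\<mu>) \<longlonglongrightarrow> 0"
  proof (rule tendsto_if_all_subseq)
    fix s :: "nat \<Rightarrow> nat" assume s: "strict_mono s"
    have "(\<lambda>k. \<epsilon> (s k)) \<longlonglongrightarrow> 0" "(\<lambda>k. h (s k)) \<longlonglongrightarrow> 0"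
      using LIMSEQ_subseq_LIMSEQ[OF \<epsilon> s] LIMSEQ_subseq_LIMSEQ[OF h s] by (simp_all add: o_def)
    from eps_optimal_plans_subseq_to_graph[OF assms(1) Tstar opt unique eps this]
    show "\<exists>r. strict_mono r \<and> (\<lambda>k. \<integral>x. V (s (r k)) x \<partial>\<mu>) \<longlonglongrightarrow> 0"
      unfolding V_def by blast
  qed
  define D where "D = diameter (UNIV :: 'b set)"
  have D: "dist y y' \<le> D" for y y' :: 'b
    unfolding D_def using compact_imp_bounded[OF cY] by (intro diameter_bounded_bound) auto
  have [measurable]: "(\<lambda>x. dist (T k x) (Tstar x)) \<in> borel_measurable \<mu>" for k
    by (rule borel_measurable_dist_compact[OF cY]) measurable
  have [measurable]: "(\<lambda>x. dist (Tstar x) y) \<in> borel_measurable \<mu>" for y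
    by (rule borel_measurable_dist_compact[OF cY]) measurable
  have [measurable]: "cell_weight \<mu> (PX k) (w k) j \<in> borel_measurable \<mu>" for k j
    by (rule measurable_cell_weight[OF PX sets_mu])
  have iV: "integrable \<mu> (V k)" for k
    unfolding V_def
  proof (intro Bochner_Integration.integrable_sum integrable_const_bound[of _ "1 * D"] AE_I2)
    fix j x assume j: "j \<in> idx (PY k)"
    show "norm (cell_weight \<mu> (PX k) (w k) j x * dist (Tstar x) (tag (PY k) j)) \<le> 1 * D"
      unfolding norm_mult using cell_weight_bounds[OF plan j, of x] D by (intro mult_mono) auto
  qed measurable
  have le: "(\<integral>x. dist (T k x) (Tstar x) \<partial>\<mu>) \<le> 2 * (\<integral>x. V k x \<partial>\<mu>) + Q * h k" for k
  proof -
    have "(\<integral>x. dist (T k x) (Tstar x) \<partial>\<mu>) \<le> (\<integral>x. 2 * V k x + Q * h k \<partial>\<mu>)"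
    proof (rule integral_mono_AE)
      show "integrable \<mu> (\<lambda>x. dist (T k x) (Tstar x))"
        using D by (intro integrable_const_bound[of _ D]) auto
      \<comment> \<open>The conditions on \<open>T k\<close> constrain its values only on cells of
        positive mass; the remaining cells form a null set.\<close>
      show "AE x in \<mu>. dist (T k x) (Tstar x) \<le> 2 * V k x + Q * h k"
        using h_plan_AE_pos[OF pmu sets_mu PX[of k]]
      proof eventually_elim
        case (elim x)
        obtain i where "i \<in> idx (PX k)" "x \<in> cell (PX k) i" using h_partition_obtain_cell[OF PX] .
        then show ?case
          unfolding V_def using elim by (intro projection_map_dist_le[OF plan T Q]) auto
      qed
    qed (use iV in auto)
    also have "\<dots> = 2 * (\<integral>x. V k x \<partial>\<mu>) + Q * h k" using iV by (simp add: prob_space)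
    finally show ?thesis .
  qed
  have "(\<lambda>k. 2 * (\<integral>x. V k x \<partial>\<mu>) + Q * h k) \<longlonglongrightarrow> 2 * 0 + Q * 0"
    by (intro tendsto_intros V0 h)
  then have "(\<lambda>k. \<integral>x. dist (T k x) (Tstar x) \<partial>\<mu>) \<longlonglongrightarrow> 0"
    unfolding mult_zero_right add_0_right
    by (rule tendsto_sandwich[OF always_eventually always_eventually tendsto_const, rotated 2])
      (auto simp: le)
  then show ?thesis
    by (intro allI impI map_dist_tendsto_if_L1[OF cY pmu]) measurable
qed

end
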